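(* Let $X$ be a complex Banach space and let $T\in\mathcal{B}(X)$ be such that $4T$ is power-bounded, i.e. $\sup_{n\ge0}\|4^nT^n\|<\infty$. Let $c=(C_n)_{n\ge0}$ be the Catalan sequence. Then: (i) The operator $C(T):=\sum_{n\ge0}C_nT^n$ is well defined (the series defines an element of $\mathcal{B}(X)$), $T$ and $C(T)$ commute, and $Y=C(T)$ is a solution of the quadratic equation $TY^2-Y+I=0$. (ii) For every $x\in X$, $$C(T)x=\frac1\pi\int_{\frac14}^\infty\frac{\sqrt{\lambda-\frac14}}{\lambda}(\lambda-T)^{-1}x\,d\lambda.$$ (iii) $TC(T)=\frac{I}{2}-\sqrt{\frac14-T}.$ (iv) The spectral mapping theorem holds for $C(T)$, i.e. $\sigma(C(T))=C(\sigma(T))$, and $$\sigma(C(T))\subset C\left(\overline{D(0,\tfrac14)}\right)\subset\sigma(c).$$ (v) If $\lambda\in\mathbb{C}\setminus\{0\}$ is such that $\frac{\lambda-1}{\lambda^2}\in\rho(T)$, then $\lambda\in\rho(C(T))$ and $$(\lambda-C(T))^{-1}=\frac{1}{\lambda}+\frac{1}{\lambda^3}\left(\frac{\lambda-1}{\lambda^2}-T\right)^{-1}+\frac{C(T)}{\lambda^2}-\frac{(\lambda-1)C(T)}{\lambda^4}\left(\frac{\lambda-1}{\lambda^2}-T\right)^{-1}.$$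
   Context: The Catalan numbers are $C_n=\frac{1}{n+1}\binom{2n}{n}$, $n\ge 0$, and $C(z)=\sum_{n=0}^\infty C_nz^n$ for $|z|\le\frac14$ (an absolutely convergent series); $D(0,\frac14)=\{z\in\mathbb{C}:|z|<\frac14\}$. $\mathcal{B}(X)$ is the algebra of bounded linear operators on $X$ with identity $I$; a scalar $\mu$ in an operator expression stands for $\mu I$. For $S\in\mathcal{B}(X)$, $\rho(S)$ is the set of $\mu\in\mathbb{C}$ such that $\mu-S$ is invertible in $\mathcal{B}(X)$ and $\sigma(S)=\mathbb{C}\setminus\rho(S)$. When $4T$ is power-bounded, $\sigma(T)\subset\overline{D(0,\frac14)}$. The square root is defined by the norm-convergent series $\sqrt{1-4T}:=\sum_{n\ge0}(-4)^n\binom{1/2}{n}T^n$, and $\sqrt{\frac14-T}:=\frac12\sqrt{1-4T}$. The algebra $\ell^1(\mathbb{N}^0,\frac1{4^n})$ consists of the complex sequences $a=(a_n)_{n\ge0}$ with $\sum_{n\ge0}\frac{|a_n|}{4^n}<\infty$, normed by this sum, with the convolution product $(a\ast b)_n=\sum_{j=0}^n a_{n-j}b_j$ and identity $\delta_0=(1,0,0,\dots)$; $\sigma(c)$ is the spectrum of $c$ in this Banach algebra, i.e. the set of $\lambda\in\mathbb{C}$ such that $\lambda\delta_0-c$ is not invertible in it. *)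

theory Defs
  imports "HOL-Analysis.Analysis"
begin

section \<open>Complex Banach spaces\<close>

class scaleC =
  fixes scaleC :: "complex \<Rightarrow> 'a \<Rightarrow> 'a"  (infixr "*\<^sub>C" 75)

class complex_normed_vector = real_normed_vector + scaleC +
  assumes scaleC_add_right: "a *\<^sub>C (x + y) = a *\<^sub>C x + a *\<^sub>C y"
    and scaleC_add_left: "(a + b) *\<^sub>C x = a *\<^sub>C x + b *\<^sub>C x"
    and scaleC_scaleC: "a *\<^sub>C b *\<^sub>C x = (a * b) *\<^sub>C x"
    and scaleC_one: "1 *\<^sub>C x = x"
    and scaleR_scaleC: "r *\<^sub>R x = complex_of_real r *\<^sub>C x"
    and norm_scaleC: "norm (a *\<^sub>C x) = cmod a * norm x"

class cbanach = complex_normed_vector + banach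

lemma bounded_linear_scaleC: "bounded_linear (\<lambda>x::'a::complex_normed_vector. a *\<^sub>C x)"
proof (rule bounded_linear_intro[where K = "cmod a"])
  fix x y :: 'a and r :: real
  show "a *\<^sub>C (x + y) = a *\<^sub>C x + a *\<^sub>C y" by (rule scaleC_add_right)
  show "a *\<^sub>C (r *\<^sub>R x) = r *\<^sub>R a *\<^sub>C x"
    by (simp add: scaleR_scaleC scaleC_scaleC mult.commute)
  show "norm (a *\<^sub>C x) \<le> norm x * cmod a" by (simp add: norm_scaleC mult.commute)
qed

text \<open>The library's bounded operators \<open>'a \<Rightarrow>\<^sub>L 'b\<close> are the real-linear ones; those into a
  complex Banach space form a complex Banach space under pointwise multiplication by scalars.\<close>

instantiation blinfun :: (real_normed_vector, complex_normed_vector) complex_normed_vector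
begin

lift_definition scaleC_blinfun :: "complex \<Rightarrow> 'a \<Rightarrow>\<^sub>L 'b \<Rightarrow> 'a \<Rightarrow>\<^sub>L 'b"
  is "\<lambda>a f x. a *\<^sub>C f x"
  by (rule bounded_linear_compose[OF bounded_linear_scaleC])

instance
proof
  fix a b :: complex and x y :: "'a \<Rightarrow>\<^sub>L 'b" and r :: real
  show "a *\<^sub>C (x + y) = a *\<^sub>C x + a *\<^sub>C y" by transfer (simp add: scaleC_add_right)
  show "(a + b) *\<^sub>C x = a *\<^sub>C x + b *\<^sub>C x" by transfer (simp add: scaleC_add_left)
  show "a *\<^sub>C b *\<^sub>C x = (a * b) *\<^sub>C x" by transfer (simp add: scaleC_scaleC)
  show "1 *\<^sub>C x = x" by transfer (simp add: scaleC_one)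
  show "r *\<^sub>R x = complex_of_real r *\<^sub>C x" by transfer (simp add: scaleR_scaleC)
  show "norm (a *\<^sub>C x) = cmod a * norm x"
  proof transfer
    fix a :: complex and f :: "'a \<Rightarrow> 'b"
    assume f: "bounded_linear f"
    have "onorm (\<lambda>x. a *\<^sub>C f x) = onorm (\<lambda>x. cmod a *\<^sub>R f x)"
      by (simp add: onorm_def norm_scaleC)
    also have "\<dots> = cmod a * onorm f"
      using onorm_scaleR[OF f, of "cmod a"] by simp
    finally show "onorm (\<lambda>x. a *\<^sub>C f x) = cmod a * onorm f" .
  qed
qed

end

instance blinfun :: (real_normed_vector, cbanach) cbanach ..


section \<open>The algebra of bounded complex-linear operators\<close>

text \<open>\<open>\<B>(X)\<close>, with the operator norm and the product \<open>(o\<^sub>L)\<close>; the norm of a complex-linear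
  operator does not depend on whether it is regarded as real or as complex linear.\<close>

definition bounded_ops :: "('a::complex_normed_vector \<Rightarrow>\<^sub>L 'a) set" where
  "bounded_ops = {S. \<forall>a x. blinfun_apply S (a *\<^sub>C x) = a *\<^sub>C blinfun_apply S x}"

primrec op_power :: "('a::real_normed_vector \<Rightarrow>\<^sub>L 'a) \<Rightarrow> nat \<Rightarrow> ('a \<Rightarrow>\<^sub>L 'a)" where
  "op_power S 0 = id_blinfun"
| "op_power S (Suc n) = S o\<^sub>L op_power S n"

definition power_bounded :: "('a::real_normed_vector \<Rightarrow>\<^sub>L 'a) \<Rightarrow> bool" where
  "power_bounded S \<longleftrightarrow> bdd_above (range (\<lambda>n. norm (op_power S n)))"

definition is_op_inverse :: "('a::complex_normed_vector \<Rightarrow>\<^sub>L 'a) \<Rightarrow> ('a \<Rightarrow>\<^sub>L 'a) \<Rightarrow> bool" where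
  "is_op_inverse S R \<longleftrightarrow> R \<in> bounded_ops \<and> S o\<^sub>L R = id_blinfun \<and> R o\<^sub>L S = id_blinfun"

definition resolvent_set :: "('a::complex_normed_vector \<Rightarrow>\<^sub>L 'a) \<Rightarrow> complex set" where
  "resolvent_set S = {\<mu>. \<exists>R. is_op_inverse (\<mu> *\<^sub>C id_blinfun - S) R}"

definition op_spectrum :: "('a::complex_normed_vector \<Rightarrow>\<^sub>L 'a) \<Rightarrow> complex set" where
  "op_spectrum S = - resolvent_set S"

text \<open>\<open>(\<mu> - S)\<inverse>\<close>; meaningful only for \<open>\<mu> \<in> resolvent_set S\<close>.\<close>

definition resolvent :: "('a::complex_normed_vector \<Rightarrow>\<^sub>L 'a) \<Rightarrow> complex \<Rightarrow> ('a \<Rightarrow>\<^sub>L 'a)" where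
  "resolvent S \<mu> = (THE R. is_op_inverse (\<mu> *\<^sub>C id_blinfun - S) R)"


section \<open>Catalan numbers and the functions they generate\<close>

definition catalan :: "nat \<Rightarrow> complex" where
  "catalan n = of_nat ((2 * n) choose n) / of_nat (n + 1)"

definition catalan_fun :: "complex \<Rightarrow> complex" where
  "catalan_fun z = (\<Sum>n. catalan n * z ^ n)"

text \<open>The operator series below are taken in the operator norm.\<close>

definition catalan_op :: "('a::cbanach \<Rightarrow>\<^sub>L 'a) \<Rightarrow> ('a \<Rightarrow>\<^sub>L 'a)" where
  "catalan_op T = (\<Sum>n. catalan n *\<^sub>C op_power T n)"

text \<open>\<open>\<surd>(1 - 4T)\<close> and \<open>\<surd>(1/4 - T)\<close>.\<close>

definition sqrt_one_minus_four :: "('a::cbanach \<Rightarrow>\<^sub>L 'a) \<Rightarrow> ('a \<Rightarrow>\<^sub>L 'a)" where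
  "sqrt_one_minus_four T = (\<Sum>n. ((- 4) ^ n * ((1 / 2) gchoose n)) *\<^sub>C op_power T n)"

definition sqrt_quarter_minus :: "('a::cbanach \<Rightarrow>\<^sub>L 'a) \<Rightarrow> ('a \<Rightarrow>\<^sub>L 'a)" where
  "sqrt_quarter_minus T = (1 / 2) *\<^sub>C sqrt_one_minus_four T"


section \<open>The convolution algebra of sequences summable with weight \<open>1 / 4 ^ n\<close>\<close>

definition weighted_l1 :: "(nat \<Rightarrow> complex) set" where
  "weighted_l1 = {a. summable (\<lambda>n. cmod (a n) / 4 ^ n)}"

definition conv :: "(nat \<Rightarrow> complex) \<Rightarrow> (nat \<Rightarrow> complex) \<Rightarrow> (nat \<Rightarrow> complex)" where
  "conv a b n = (\<Sum>j\<le>n. a (n - j) * b j)"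

definition delta0 :: "nat \<Rightarrow> complex" where
  "delta0 n = (if n = 0 then 1 else 0)"

text \<open>For \<open>c \<in> weighted_l1\<close> this is the spectrum of \<open>c\<close>; the norm of the algebra does not enter.\<close>

definition l1_spectrum :: "(nat \<Rightarrow> complex) \<Rightarrow> complex set" where
  "l1_spectrum c =
    {l. \<not> (\<exists>b\<in>weighted_l1. conv (\<lambda>n. l * delta0 n - c n) b = delta0 \<and>
                            conv b (\<lambda>n. l * delta0 n - c n) = delta0)}"


section \<open>Integrals of vector-valued functions\<close>

text \<open>The library's Bochner integral is confined to second-countable spaces, so that the integral
  in a Banach space is expressed by the gauge integral together with integrability of the norm.
  For a continuous integrand on an open interval this amounts to Bochner integrability, and the
  values of the two integrals agree.\<close>

definition norm_integrable_on :: "(real \<Rightarrow> 'a::banach) \<Rightarrow> real set \<Rightarrow> bool" where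
  "norm_integrable_on f A \<longleftrightarrow> f integrable_on A \<and> (\<lambda>t. norm (f t)) integrable_on A"

end

theory Submission
  imports Defs "HOL-Real_Asymp.Real_Asymp"
begin

text \<open>
  The identity \<open>C\<^sub>n\<^sub>+\<^sub>1 = \<Sum> C\<^sub>i C\<^sub>n\<^sub>-\<^sub>i\<close> makes \<open>Y = C(T)\<close> a root of \<open>T Y\<^sup>2 - Y + 1\<close>. Comparing with a scalar
  root \<open>l\<close> of \<open>z l\<^sup>2 - l + 1\<close>, i.e. \<open>z = (l - 1) / l\<^sup>2\<close>, factorises \<open>z - T\<close> through \<open>l - Y\<close>, which
  yields the resolvent formula and, up to the choice between the two roots, the spectral mapping
  theorem. That choice is settled without Gelfand theory: \<open>\<Sum> C\<^sub>n / 4^n \<le> 2\<close> bounds \<open>Y^k\<close> by a multiple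
  of \<open>2^k\<close>, so the spectrum of \<open>Y\<close> lies in the disc of radius 2, whereas the root other than \<open>C(z)\<close>
  lies outside it, unless \<open>z = 1/4\<close> and the root is double. The integral formula follows by integrating the Neumann series of the
  resolvent termwise.
\<close>

section \<open>Termwise integration in Banach spaces\<close>

text \<open>Over any one division the Riemann sums of \<open>f\<close> and \<open>g\<close> differ
  by at most that of \<open>G\<close>, which a fine division makes small. Hence the Riemann sums of
  \<open>f\<close> are Cauchy, and completeness yields the integral.\<close>

lemma integrable_on_cbox_approx:
  fixes f :: "'n::euclidean_space \<Rightarrow> 'b::banach"
  assumes approx: "\<And>e::real. e > 0 \<Longrightarrow> \<exists>g G. g integrable_on cbox a b \<and> G integrable_on cbox a b \<and>
    integral (cbox a b) G \<le> e \<and> (\<forall>x\<in>cbox a b. norm (f x - g x) \<le> G x)"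
  shows "f integrable_on cbox a b"
  unfolding integrable_Cauchy
proof (intro allI impI)
  fix e :: real
  assume "e > 0"
  then have e: "e / 6 > 0" by simp
  obtain g G where g: "g integrable_on cbox a b" and G: "G integrable_on cbox a b"
    and small: "integral (cbox a b) G \<le> e / 6"
    and fg: "\<And>x. x \<in> cbox a b \<Longrightarrow> norm (f x - g x) \<le> G x"
    using approx[OF e] by blast
  obtain \<gamma>1 where \<gamma>1: "gauge \<gamma>1" and sum_g: "\<And>\<D>. \<D> tagged_division_of (cbox a b) \<Longrightarrow> \<gamma>1 fine \<D> \<Longrightarrow>
      norm ((\<Sum>(x,k)\<in>\<D>. measure lborel k *\<^sub>R g x) - integral (cbox a b) g) < e / 6"
    using has_integralD[OF integrable_integral[OF g] e] by metis
  obtain \<gamma>2 where \<gamma>2: "gauge \<gamma>2" and sum_G: "\<And>\<D>. \<D> tagged_division_of (cbox a b) \<Longrightarrow> \<gamma>2 fine \<D> \<Longrightarrow>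
      norm ((\<Sum>(x,k)\<in>\<D>. measure lborel k *\<^sub>R G x) - integral (cbox a b) G) < e / 6"
    using has_integralD[OF integrable_integral[OF G] e] by metis
  \<comment> \<open>Error budget: the Riemann sum of \<open>G\<close> stays below
    \<open>e / 6 + e / 6\<close>, and that of \<open>g\<close> is within \<open>e / 6\<close> of its
    integral. Two divisions are later compared through this integral.\<close>
  have close: "norm ((\<Sum>(x,k)\<in>\<D>. measure lborel k *\<^sub>R f x) - integral (cbox a b) g) < e / 2"
    if D: "\<D> tagged_division_of (cbox a b)" "\<gamma>1 fine \<D>" "\<gamma>2 fine \<D>" for \<D>
  proof -
    have "norm ((\<Sum>(x,k)\<in>\<D>. measure lborel k *\<^sub>R f x) - (\<Sum>(x,k)\<in>\<D>. measure lborel k *\<^sub>R g x))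
        = norm (\<Sum>(x,k)\<in>\<D>. measure lborel k *\<^sub>R (f x - g x))"
      by (simp add: sum_subtractf[symmetric] case_prod_beta scaleR_diff_right)
    also have "\<dots> \<le> (\<Sum>(x,k)\<in>\<D>. measure lborel k *\<^sub>R G x)"
      using D(1) by (intro order_trans[OF norm_sum] sum_mono)
        (use tagged_division_ofD(2,3)[OF D(1)] in \<open>fastforce intro!: mult_left_mono fg\<close>)
    also have "\<dots> < e / 3"
      using sum_G[OF D(1,3)] small unfolding real_norm_def real_scaleR_def by linarith
    finally have "norm ((\<Sum>(x,k)\<in>\<D>. measure lborel k *\<^sub>R f x) - (\<Sum>(x,k)\<in>\<D>. measure lborel k *\<^sub>R g x)) < e / 3" .
    with sum_g[OF D(1,2)] show ?thesis
      using norm_triangle_ineq[of "(\<Sum>(x,k)\<in>\<D>. measure lborel k *\<^sub>R f x) - (\<Sum>(x,k)\<in>\<D>. measure lborel k *\<^sub>R g x)"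
          "(\<Sum>(x,k)\<in>\<D>. measure lborel k *\<^sub>R g x) - integral (cbox a b) g"]
      by (simp)
  qed
  show "\<exists>\<gamma>. gauge \<gamma> \<and>
    (\<forall>\<D>1 \<D>2. \<D>1 tagged_division_of (cbox a b) \<and> \<gamma> fine \<D>1 \<and>
       \<D>2 tagged_division_of (cbox a b) \<and> \<gamma> fine \<D>2 \<longrightarrow>
       norm ((\<Sum>(x,k)\<in>\<D>1. measure lborel k *\<^sub>R f x) - (\<Sum>(x,k)\<in>\<D>2. measure lborel k *\<^sub>R f x)) < e)"
  proof (intro exI[of _ "\<lambda>x. \<gamma>1 x \<inter> \<gamma>2 x"] conjI allI impI)
    show "gauge (\<lambda>x. \<gamma>1 x \<inter> \<gamma>2 x)" using \<gamma>1 \<gamma>2 by (rule gauge_Int)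
    fix \<D>1 \<D>2
    assume "\<D>1 tagged_division_of (cbox a b) \<and> (\<lambda>x. \<gamma>1 x \<inter> \<gamma>2 x) fine \<D>1 \<and>
       \<D>2 tagged_division_of (cbox a b) \<and> (\<lambda>x. \<gamma>1 x \<inter> \<gamma>2 x) fine \<D>2"
    then show "norm ((\<Sum>(x,k)\<in>\<D>1. measure lborel k *\<^sub>R f x) - (\<Sum>(x,k)\<in>\<D>2. measure lborel k *\<^sub>R f x)) < e"
      by (intro norm_triangle_half_l[OF close close]) (auto simp: fine_Int)
  qed
qed

text \<open>Extension by zero reduces integrability to boxes. Since \<open>G\<close> is nonnegative
  on \<open>S\<close>, the box integrals of \<open>f\<close> and \<open>g\<close> differ by at most
  \<open>k\<close>; those of \<open>g\<close> tend to \<open>J\<close>, which is close to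
  \<open>I\<close>.\<close>

lemma has_integral_approx:
  fixes f :: "'n::euclidean_space \<Rightarrow> 'b::banach"
  assumes approx: "\<And>e::real. e > 0 \<Longrightarrow> \<exists>g J G k. (g has_integral J) S \<and> (G has_integral k) S \<and>
    norm (J - I) \<le> e \<and> k \<le> e \<and> (\<forall>x\<in>S. norm (f x - g x) \<le> G x)"
  shows "(f has_integral I) S"
proof -
  let ?r = "\<lambda>h x. if x \<in> S then h x else 0"
  have box_le: "integral (cbox a b) (?r G) \<le> k"
    if G: "(G has_integral k) S" and "\<And>x. x \<in> S \<Longrightarrow> 0 \<le> G x" for G :: "'n \<Rightarrow> real" and k a b
  proof -
    have "(?r G) integrable_on UNIV" "integral UNIV (?r G) = k"
      using G by (auto simp: integrable_restrict_UNIV integral_restrict_UNIV integrable_on_def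
          dest: integral_unique)
    moreover from this have "(?r G) integrable_on cbox a b"
      by (intro integrable_on_subcbox[of _ UNIV]) auto
    ultimately show ?thesis
      using integral_subset_le[of "cbox a b" UNIV "?r G"] that by auto
  qed
  have int: "(?r f) integrable_on cbox a b" for a b
  proof (rule integrable_on_cbox_approx)
    fix e :: real assume "e > 0"
    then obtain g J G k where *: "(g has_integral J) S" "(G has_integral k) S" "k \<le> e"
      "\<forall>x\<in>S. norm (f x - g x) \<le> G x"
      using approx by metis
    have "integral (cbox a b) (?r G) \<le> e"
      using box_le[OF *(2), of a b] *(3,4) norm_ge_zero order_trans by metis
    moreover have "(?r g) integrable_on cbox a b" "(?r G) integrable_on cbox a b"
      using *(1,2) by (auto simp: integrable_altD(1) integrable_on_def[of g S] integrable_on_def[of G S])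
    ultimately show "\<exists>g G. g integrable_on cbox a b \<and> G integrable_on cbox a b \<and>
        integral (cbox a b) G \<le> e \<and> (\<forall>x\<in>cbox a b. norm (?r f x - g x) \<le> G x)"
      using *(4) by (intro exI[of _ "?r g"] exI[of _ "?r G"]) auto
  qed
  show ?thesis
    unfolding has_integral_alt'
  proof (intro conjI allI impI)
    show "(?r f) integrable_on cbox a b" for a b by (rule int)
    fix e :: real assume "e > 0"
    then have e4: "e / 4 > 0" by simp
    then obtain g J G k where *: "(g has_integral J) S" "(G has_integral k) S" "norm (J - I) \<le> e / 4"
      "k \<le> e / 4" "\<forall>x\<in>S. norm (f x - g x) \<le> G x"
      using approx by meson
    obtain B where B: "B > 0"
      "\<And>a b. ball 0 B \<subseteq> cbox a b \<Longrightarrow> norm (integral (cbox a b) (?r g) - J) < e / 4"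
      using *(1) e4 unfolding has_integral_alt' by meson
    have "norm (integral (cbox a b) (?r f) - I) < e" if ab: "ball 0 B \<subseteq> cbox a b" for a b
    proof -
      have g: "(?r g) integrable_on cbox a b" and G: "(?r G) integrable_on cbox a b"
        using *(1,2) by (auto simp: integrable_altD(1) integrable_on_def[of g S] integrable_on_def[of G S])
      have "norm (integral (cbox a b) (?r f) - integral (cbox a b) (?r g))
          = norm (integral (cbox a b) (\<lambda>x. ?r f x - ?r g x))"
        by (subst integral_diff[OF int g]) simp
      also have "\<dots> \<le> integral (cbox a b) (?r G)"
        using *(5) by (intro integral_norm_bound_integral integrable_diff int g G) auto
      also have "\<dots> \<le> e / 4"
        using box_le[OF *(2), of a b] *(4,5) norm_ge_zero order_trans by metis
      finally have 1: "norm (integral (cbox a b) (?r f) - integral (cbox a b) (?r g)) \<le> e / 4" .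
      have "integral (cbox a b) (?r f) - I = (integral (cbox a b) (?r f) - integral (cbox a b) (?r g))
          + (integral (cbox a b) (?r g) - J) + (J - I)" by simp
      then have "norm (integral (cbox a b) (?r f) - I) \<le> e / 4 + e / 4 + e / 4"
        using 1 B(2)[OF ab] *(3) by (simp only:) (intro norm_triangle_mono; simp)
      with \<open>e > 0\<close> show ?thesis by simp
    qed
    with B(1) show "\<exists>B>0. \<forall>a b. ball 0 B \<subseteq> cbox a b \<longrightarrow> norm (integral (cbox a b) (?r f) - I) < e"
      by blast
  qed
qed

text \<open>A partial sum serves as \<open>g\<close> in \<open>has_integral_approx\<close> and the
  tail of the series of norms as \<open>G\<close>. By monotone convergence the integral of this tail
  is the tail of \<open>J\<close>, hence small. The second claim supplies an integrable majorant of
  the sum.\<close>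

lemma has_integral_suminf:
  fixes f :: "nat \<Rightarrow> 'n::euclidean_space \<Rightarrow> 'b::banach"
  assumes f: "\<And>n. (f n has_integral I n) S"
    and nf: "\<And>n. ((\<lambda>x. norm (f n x)) has_integral J n) S"
    and J: "summable J"
    and pw: "\<And>x. x \<in> S \<Longrightarrow> summable (\<lambda>n. norm (f n x))"
  shows "((\<lambda>x. \<Sum>n. f n x) has_integral (\<Sum>n. I n)) S"
    and "(\<lambda>x. \<Sum>n. norm (f n x)) integrable_on S"
proof -
  have I_le: "norm (I n) \<le> J n" for n
  proof -
    have "norm (integral S (f n)) \<le> integral S (\<lambda>x. norm (f n x))"
      using f nf by (intro integral_norm_bound_integral) (auto simp: integrable_on_def)
    then show ?thesis by (simp only: integral_unique[OF f] integral_unique[OF nf])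
  qed
  have sumI: "summable I" using J I_le by (rule summable_comparison_test'[of _ 0])
  have psum: "((\<lambda>x. \<Sum>n<N. norm (f n x)) has_integral (\<Sum>n<N. J n)) S" for N
    by (intro has_integral_sum nf) auto
  have G: "((\<lambda>x. \<Sum>n. norm (f n x)) has_integral (\<Sum>n. J n)) S"
  proof (rule has_integral_monotone_convergence_increasing[OF psum])
    show "(\<lambda>N. \<Sum>n<N. norm (f n x)) \<longlonglongrightarrow> (\<Sum>n. norm (f n x))" if "x \<in> S" for x
      using summable_LIMSEQ[OF pw[OF that]] .
    show "(\<lambda>N. \<Sum>n<N. J n) \<longlonglongrightarrow> (\<Sum>n. J n)" using summable_LIMSEQ[OF J] .
  qed auto
  then show "(\<lambda>x. \<Sum>n. norm (f n x)) integrable_on S" by blast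
  show "((\<lambda>x. \<Sum>n. f n x) has_integral (\<Sum>n. I n)) S"
  proof (rule has_integral_approx)
    fix e :: real assume "e > 0"
    have "(\<lambda>N. (\<Sum>n. J n) - (\<Sum>n<N. J n)) \<longlonglongrightarrow> (\<Sum>n. J n) - (\<Sum>n. J n)"
      by (intro tendsto_intros summable_LIMSEQ J)
    then have "\<forall>\<^sub>F N in sequentially. (\<Sum>n. J n) - (\<Sum>n<N. J n) < e"
      using \<open>e > 0\<close> by (simp add: order_tendstoD)
    moreover have "\<forall>\<^sub>F N in sequentially. dist (\<Sum>n<N. I n) (\<Sum>n. I n) < e"
      using summable_LIMSEQ[OF sumI] \<open>e > 0\<close> by (rule tendstoD)
    ultimately obtain N where N: "(\<Sum>n. J n) - (\<Sum>n<N. J n) < e" "dist (\<Sum>n<N. I n) (\<Sum>n. I n) < e"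
      by (metis (mono_tags, lifting) eventually_at_top_linorder eventually_conj order_refl)
    have tail: "norm ((\<Sum>n. f n x) - (\<Sum>n<N. f n x)) \<le> (\<Sum>n. norm (f n x)) - (\<Sum>n<N. norm (f n x))"
      if x: "x \<in> S" for x
    proof -
      have "(\<Sum>n. f n x) - (\<Sum>n<N. f n x) = (\<Sum>n. f (n + N) x)"
        by (subst suminf_minus_initial_segment) (auto intro: summable_norm_cancel pw x)
      also have "norm \<dots> \<le> (\<Sum>n. norm (f (n + N) x))"
        by (rule summable_norm) (use pw[OF x] in \<open>subst summable_iff_shift\<close>)
      also have "\<dots> = (\<Sum>n. norm (f n x)) - (\<Sum>n<N. norm (f n x))"
        by (rule suminf_minus_initial_segment[OF pw[OF x]])
      finally show ?thesis .
    qed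
    have "((\<lambda>x. \<Sum>n<N. f n x) has_integral (\<Sum>n<N. I n)) S"
      by (intro has_integral_sum f) auto
    moreover have "((\<lambda>x. (\<Sum>n. norm (f n x)) - (\<Sum>n<N. norm (f n x)))
        has_integral (\<Sum>n. J n) - (\<Sum>n<N. J n)) S"
      by (intro has_integral_diff G psum)
    ultimately show "\<exists>g Ia G k. (g has_integral Ia) S \<and> (G has_integral k) S \<and>
        norm (Ia - (\<Sum>n. I n)) \<le> e \<and> k \<le> e \<and> (\<forall>x\<in>S. norm ((\<Sum>n. f n x) - g x) \<le> G x)"
      using N tail by (intro exI conjI) (auto simp: dist_norm)
  qed
qed


section \<open>Catalan numbers\<close>

text \<open>Two absorption identities and the symmetry of row \<open>2n + 1\<close> relate
  consecutive central binomial coefficients. The same ratio governs the binomial series of the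
  square root and the moments below.\<close>

lemma catalan_rec: "catalan (Suc n) = 2 * of_nat (2 * n + 1) / of_nat (n + 2) * catalan n"
proof -
  have "Suc n * (2 * Suc n choose Suc n) = 2 * (2 * n + 1) * (2 * n choose n)"
    using Suc_times_binomial_eq[of "Suc (2 * n)" n] Suc_times_binomial_eq[of "2 * n" n]
      binomial_symmetric[of n "Suc (2 * n)"] by (simp add: algebra_simps)
  then have "of_nat (Suc n) * (of_nat (2 * Suc n choose Suc n) :: complex)
      = 2 * of_nat (2 * n + 1) * of_nat (2 * n choose n)"
    by (metis of_nat_mult of_nat_numeral)
  then have *: "(of_nat (2 * Suc n choose Suc n) :: complex)
      = 2 * of_nat (2 * n + 1) * of_nat (2 * n choose n) / of_nat (Suc n)"
    by (simp add: eq_divide_eq mult.commute del: binomial_Suc_Suc of_nat_Suc)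
  have "(of_nat (n + 2) :: complex) \<noteq> 0" "(of_nat (Suc n) :: complex) \<noteq> 0"
    by (simp_all only: of_nat_eq_0_iff)
  then show ?thesis
    unfolding catalan_def *
    by (simp add: field_simps del: of_nat_Suc of_nat_add)
qed

text \<open>Coefficientwise form of \<open>sqrt (1 - 4z) = 1 - 2 z C(z)\<close>: both sides have the
  same ratio of consecutive terms.\<close>

lemma catalan_eq_gbinomial: "(- 4) ^ Suc n * ((1 / 2 :: complex) gchoose Suc n) = - 2 * catalan n"
proof (induction n)
  case 0
  show ?case by (simp add: catalan_def)
next
  case (Suc n)
  have "of_nat (Suc (Suc n)) * ((1 / 2 :: complex) gchoose Suc (Suc n))
      = (1 / 2 - of_nat (Suc n)) * ((1 / 2) gchoose Suc n)"
    by (rule trans[OF gbinomial_absorption gbinomial_absorb_comp[symmetric]])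
  then have G: "((1 / 2 :: complex) gchoose Suc (Suc n))
      = (1 / 2 - of_nat (Suc n)) * ((1 / 2) gchoose Suc n) / of_nat (Suc (Suc n))"
    by (simp add: eq_divide_eq mult.commute del: of_nat_Suc)
  have "(- 4) ^ Suc (Suc n) * ((1 / 2 :: complex) gchoose Suc (Suc n))
      = (- 4) * (1 / 2 - of_nat (Suc n)) / of_nat (Suc (Suc n)) * ((- 4) ^ Suc n * ((1 / 2) gchoose Suc n))"
    by (simp only: G power_Suc[of _ "Suc n"] times_divide_eq_left times_divide_eq_right ac_simps)
  also have "\<dots> = - 2 * catalan (Suc n)"
  proof -
    have "(- 4) * (1 / 2 - of_nat (Suc n)) = (2 * of_nat (2 * n + 1) :: complex)"
      by (simp add: algebra_simps)
    then show ?thesis unfolding Suc.IH catalan_rec by simp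
  qed
  finally show ?case .
qed

text \<open>Vandermonde's identity for \<open>1/2 + 1/2 = 1\<close>: the square of the series of \<open>\<surd>(1 - 4z)\<close> is
  \<open>1 - 4z\<close>.\<close>

lemma catalan_convolution: "(\<Sum>i\<le>n. catalan i * catalan (n - i)) = catalan (Suc n)"
proof -
  define s where "s = (\<lambda>n. (- 4) ^ n * ((1 / 2 :: complex) gchoose n))"
  have s: "s 0 = 1" "s (Suc n) = - 2 * catalan n" for n
    using catalan_eq_gbinomial by (simp_all only: s_def power_0 gbinomial_0 mult_1)
  have "(\<Sum>k\<le>Suc (Suc n). s k * s (Suc (Suc n) - k))
      = (- 4) ^ Suc (Suc n) * (\<Sum>k\<le>Suc (Suc n). ((1 / 2) gchoose k) * ((1 / 2) gchoose (Suc (Suc n) - k)))"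
    unfolding sum_distrib_left
  proof (intro sum.cong refl)
    fix k assume "k \<in> {..Suc (Suc n)}"
    then have "(- 4 :: complex) ^ Suc (Suc n) = (- 4) ^ k * (- 4) ^ (Suc (Suc n) - k)"
      by (simp flip: power_add)
    then show "s k * s (Suc (Suc n) - k)
        = (- 4) ^ Suc (Suc n) * (((1 / 2) gchoose k) * ((1 / 2) gchoose (Suc (Suc n) - k)))"
      by (simp add: s_def)
  qed
  also have "\<dots> = (- 4) ^ Suc (Suc n) * ((1 :: complex) gchoose Suc (Suc n))"
    using gbinomial_Vandermonde[of "1 / 2 :: complex" "1 / 2" "Suc (Suc n)"] by (simp add: atMost_atLeast0)
  \<comment> \<open>The binomial series of exponent 1 stops at index 1, so the total index
    \<open>n + 2\<close> makes the sum vanish for every \<open>n\<close>.\<close>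
  also have "(1 :: complex) gchoose Suc (Suc n) = 0"
    using binomial_gbinomial[of 1 "Suc (Suc n)", where 'a = complex] by simp
  finally have "(\<Sum>k\<le>Suc (Suc n). s k * s (Suc (Suc n) - k)) = 0" by simp
  \<comment> \<open>The two end terms, with \<open>s 0 = 1\<close>, contribute
    \<open>-4 C_(n+1)\<close> together; each inner term carries the factor
    \<open>(-2)^2\<close>.\<close>
  moreover have "(\<Sum>k\<le>Suc (Suc n). s k * s (Suc (Suc n) - k))
      = s 0 * s (Suc (Suc n)) + (\<Sum>k\<le>n. s (Suc k) * s (Suc (n - k))) + s (Suc (Suc n)) * s 0"
    by (subst sum.atMost_Suc_shift, subst sum.atMost_Suc) (simp add: Suc_diff_le)
  moreover have "(\<Sum>k\<le>n. s (Suc k) * s (Suc (n - k))) = 4 * (\<Sum>i\<le>n. catalan i * catalan (n - i))"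
    by (simp add: s sum_distrib_left)
  ultimately show ?thesis by (simp add: s)
qed

text \<open>The sum telescopes, since \<open>C\<^sub>n / 4^n = 2 (b\<^sub>n - b\<^sub>n\<^sub>+\<^sub>1)\<close> for \<open>b\<^sub>n = (n + 1) C\<^sub>n / 4^n\<close>, the
  normalised central binomial coefficient.\<close>

lemma catalan_partial_sum:
  "(\<Sum>i<n. cmod (catalan i) / 4 ^ i) = 2 - 2 * real (n + 1) * cmod (catalan n) / 4 ^ n"
proof (induction n)
  case 0
  show ?case by (simp add: catalan_def)
next
  case (Suc n)
  have "cmod (catalan (Suc n)) = 2 * real (2 * n + 1) / real (n + 2) * cmod (catalan n)"
    by (simp only: catalan_rec norm_mult norm_divide norm_of_nat norm_numeral)
  then have "real (n + 2) * cmod (catalan (Suc n)) = 2 * real (2 * n + 1) * cmod (catalan n)"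
    by (simp add: field_simps)
  then have "2 * real (Suc n + 1) * cmod (catalan (Suc n)) = 4 * (real (2 * n + 1) * cmod (catalan n))"
    by (simp add: algebra_simps)
  then have "2 * real (Suc n + 1) * cmod (catalan (Suc n)) / 4 ^ Suc n
      = real (2 * n + 1) * cmod (catalan n) / 4 ^ n"
    by (simp only: power_Suc mult_divide_mult_cancel_left_if) simp
  moreover have "2 * real (n + 1) * cmod (catalan n) / 4 ^ n - cmod (catalan n) / 4 ^ n
      = real (2 * n + 1) * cmod (catalan n) / 4 ^ n"
    by (simp add: field_simps)
  ultimately show ?case using Suc by simp
qed

lemma summable_catalan_weighted: "summable (\<lambda>n. cmod (catalan n) / 4 ^ n)"
  and catalan_weighted_sum_le: "(\<Sum>n. cmod (catalan n) / 4 ^ n) \<le> 2"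
proof -
  have le: "(\<Sum>i<n. cmod (catalan i) / 4 ^ i) \<le> 2" for n
    by (simp add: catalan_partial_sum)
  show "summable (\<lambda>n. cmod (catalan n) / 4 ^ n)"
    by (rule summableI_nonneg_bounded[OF _ le]) simp
  then show "(\<Sum>n. cmod (catalan n) / 4 ^ n) \<le> 2"
    by (rule suminf_le_const) (rule le)
qed

section \<open>The generating function on the closed disc of radius 1/4\<close>

lemma norm_catalan_term_le:
  assumes "cmod z \<le> 1 / 4"
  shows "norm (catalan n * z ^ n) \<le> cmod (catalan n) / 4 ^ n"
proof -
  have "norm (catalan n * z ^ n) \<le> cmod (catalan n) * (1 / 4) ^ n"
    using assms by (simp add: norm_mult norm_power mult_left_mono power_mono)
  then show ?thesis by (simp add: power_divide)
qed

lemma summable_norm_catalan: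
  assumes "cmod z \<le> 1 / 4"
  shows "summable (\<lambda>n. norm (catalan n * z ^ n))"
  using norm_catalan_term_le[OF assms]
  by (intro summable_comparison_test'[OF summable_catalan_weighted, of 0]) simp

text \<open>By \<open>catalan_convolution\<close>, squaring the series shifts its coefficients by
  one; multiplication by \<open>z\<close> restores the exponents, and only the constant term
  \<open>C_0 = 1\<close> is missing.\<close>

lemma catalan_fun_quadratic:
  assumes "cmod z \<le> 1 / 4"
  shows "z * (catalan_fun z)\<^sup>2 - catalan_fun z + 1 = 0"
proof -
  note S = summable_norm_catalan[OF assms]
  have "(\<lambda>n. \<Sum>i\<le>n. (catalan i * z ^ i) * (catalan (n - i) * z ^ (n - i)))
      sums (catalan_fun z * catalan_fun z)"
    using Cauchy_product_sums[OF S S] by (simp add: catalan_fun_def)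
  moreover have "(\<Sum>i\<le>n. (catalan i * z ^ i) * (catalan (n - i) * z ^ (n - i))) = catalan (Suc n) * z ^ n" for n
  proof -
    have "(\<Sum>i\<le>n. (catalan i * z ^ i) * (catalan (n - i) * z ^ (n - i)))
        = (\<Sum>i\<le>n. catalan i * catalan (n - i) * z ^ n)"
    proof (intro sum.cong refl)
      fix i assume "i \<in> {..n}"
      then have "z ^ n = z ^ i * z ^ (n - i)" by (simp flip: power_add)
      then show "(catalan i * z ^ i) * (catalan (n - i) * z ^ (n - i)) = catalan i * catalan (n - i) * z ^ n"
        by simp
    qed
    then show ?thesis by (simp only: sum_distrib_right[symmetric] catalan_convolution)
  qed
  ultimately have "(\<lambda>n. catalan (Suc n) * z ^ n) sums ((catalan_fun z)\<^sup>2)"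
    by (simp add: power2_eq_square)
  then have "(\<lambda>n. z * (catalan (Suc n) * z ^ n)) sums (z * (catalan_fun z)\<^sup>2)"
    by (rule sums_mult)
  moreover have "(\<lambda>n. catalan (Suc n) * z ^ Suc n) sums (catalan_fun z - catalan 0 * z ^ 0)"
    using summable_sums[OF summable_norm_cancel[OF S]] unfolding catalan_fun_def
    by (subst sums_Suc_iff) simp
  ultimately have "z * (catalan_fun z)\<^sup>2 = catalan_fun z - 1"
    by (auto simp: catalan_def mult_ac dest: sums_unique2)
  then show ?thesis by simp
qed

lemma cmod_catalan_fun_le:
  assumes "cmod z \<le> 1 / 4"
  shows "cmod (catalan_fun z) \<le> 2"
proof -
  have "cmod (catalan_fun z) \<le> (\<Sum>n. norm (catalan n * z ^ n))"
    unfolding catalan_fun_def by (rule summable_norm[OF summable_norm_catalan[OF assms]])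
  also have "\<dots> \<le> (\<Sum>n. cmod (catalan n) / 4 ^ n)"
    by (intro suminf_le norm_catalan_term_le summable_norm_catalan summable_catalan_weighted assms)
  also have "\<dots> \<le> 2" by (rule catalan_weighted_sum_le)
  finally show ?thesis .
qed

text \<open>Strictness comes from the first two terms alone: \<open>1 + z\<close> has modulus below
  \<open>5/4\<close> unless \<open>z = 1/4\<close>. The other terms are bounded by their values at
  \<open>1/4\<close>, which sum to at most \<open>2 - 5/4\<close>.\<close>

lemma cmod_catalan_fun_less:
  assumes z: "cmod z \<le> 1 / 4" "z \<noteq> 1 / 4"
  shows "cmod (catalan_fun z) < 2"
proof -
  let ?f = "\<lambda>n. catalan n * z ^ n" and ?g = "\<lambda>n. cmod (catalan n) / 4 ^ n"
  have c: "catalan 0 = 1" "catalan 1 = 1" by (simp_all add: catalan_def)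
  note S = summable_norm_catalan[OF z(1)]
  have "catalan_fun z = (\<Sum>n. ?f (n + 2)) + (\<Sum>n<2. ?f n)"
    unfolding catalan_fun_def by (rule suminf_split_initial_segment[OF summable_norm_cancel[OF S]])
  also have "(\<Sum>n<2. ?f n) = 1 + z"
    using c by (simp add: numeral_2_eq_2)
  finally have "cmod (catalan_fun z) \<le> cmod (\<Sum>n. ?f (n + 2)) + cmod (1 + z)"
    by (metis norm_triangle_ineq)
  moreover have "cmod (\<Sum>n. ?f (n + 2)) \<le> (\<Sum>n. norm (?f (n + 2)))"
    using S by (intro summable_norm) (subst summable_iff_shift)
  moreover have "(\<Sum>n. norm (?f (n + 2))) \<le> (\<Sum>n. ?g (n + 2))"
    using S summable_catalan_weighted
    by (intro suminf_le norm_catalan_term_le z(1)) (subst summable_iff_shift, assumption)+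
  moreover have "(\<Sum>n. ?g (n + 2)) = (\<Sum>n. ?g n) - (\<Sum>n<2. ?g n)"
    by (rule suminf_minus_initial_segment[OF summable_catalan_weighted])
  moreover have "(\<Sum>n<2. ?g n) = 5 / 4"
    using c by (simp add: numeral_2_eq_2)
  moreover have "cmod (1 + z) < 5 / 4"
  proof -
    have "Re z < 1 / 4"
    proof (rule ccontr)
      assume "\<not> Re z < 1 / 4"
      then have Re: "Re z = 1 / 4"
        using z(1) complex_Re_le_cmod[of z] by simp
      moreover have "(cmod z)\<^sup>2 \<le> (1 / 4)\<^sup>2" by (intro power_mono z(1)) simp
      ultimately have "(Im z)\<^sup>2 \<le> 0" by (simp only: cmod_power2)
      then have "Im z = 0" by simp
      with Re z(2) show False by (simp add: complex_eq_iff)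
    qed
    moreover have "(cmod z)\<^sup>2 \<le> 1 / 16"
      using power_mono[OF z(1), of 2] by (simp add: power_divide)
    moreover have "(cmod (1 + z))\<^sup>2 = 1 + 2 * Re z + (cmod z)\<^sup>2"
      unfolding cmod_power2 by (simp add: power2_eq_square algebra_simps)
    ultimately have "(cmod (1 + z))\<^sup>2 < (5 / 4)\<^sup>2"
      by (simp add: power_divide)
    then show ?thesis by (rule power_less_imp_less_base) simp
  qed
  ultimately show ?thesis using catalan_weighted_sum_le by simp
qed

text \<open>The two roots of \<open>z w\<^sup>2 - w + 1\<close> have product \<open>1 / z\<close>, of modulus at least 4, and \<open>C(z)\<close>
  has modulus less than 2 unless \<open>z = 1/4\<close>, where the root is double.\<close>

lemma catalan_fun_unique:
  assumes z: "cmod z \<le> 1 / 4" and w: "z * w\<^sup>2 - w + 1 = 0" "cmod w \<le> 2"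
  shows "w = catalan_fun z"
proof (rule ccontr)
  let ?C = "catalan_fun z"
  assume neq: "w \<noteq> ?C"
  note C = catalan_fun_quadratic[OF z]
  \<comment> \<open>Difference of the two quadratic equations; cancelling \<open>w - C(z)\<close>
    leaves Vieta's relation for the sum of the roots.\<close>
  have "(w - ?C) * (z * (w + ?C) - 1) = 0"
  proof -
    have "(w - ?C) * (z * (w + ?C) - 1) = (z * w\<^sup>2 - w + 1) - (z * ?C\<^sup>2 - ?C + 1)"
      by (simp add: algebra_simps power2_eq_square)
    then show ?thesis by (simp only: C w(1) diff_0_right)
  qed
  with neq have sum: "z * (w + ?C) = 1" by simp
  have prod: "z * (w * ?C) = 1"
  proof -
    have "z * (w * ?C) = w * (z * (w + ?C)) - z * w\<^sup>2"
      by (simp add: algebra_simps power2_eq_square)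
    also have "\<dots> = 1" using w(1) sum by (simp add: algebra_simps)
    finally show ?thesis .
  qed
  show False
  proof (cases "z = 1 / 4")
    case True
    \<comment> \<open>Here the quadratic is \<open>(w - 2)^2 / 4\<close>.\<close>
    have "(w - 2)\<^sup>2 = 0" "(?C - 2)\<^sup>2 = 0"
      using w(1) C by (simp_all add: True power2_eq_square field_simps)
    with neq show False by simp
  next
    case False
    have "1 = cmod z * (cmod w * cmod ?C)"
      using arg_cong[OF prod, of cmod] by (simp add: norm_mult)
    also have "\<dots> \<le> 1 / 4 * (2 * cmod ?C)"
      using z w(2) by (intro mult_mono) auto
    also have "\<dots> < 1" using cmod_catalan_fun_less[OF z False] by simp
    finally show False by simp
  qed
qed

text \<open>Evaluation at \<open>z\<close> is a character of the convolution algebra, multiplicative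
  by the Cauchy product. It sends \<open>C(z) delta0 - c\<close> to 0 but \<open>delta0\<close> to
  1, so the former has no inverse.\<close>

lemma catalan_fun_in_l1_spectrum:
  assumes "cmod z \<le> 1 / 4"
  shows "catalan_fun z \<in> l1_spectrum catalan"
proof (rule ccontr)
  let ?a = "\<lambda>n. catalan_fun z * delta0 n - catalan n"
  assume "catalan_fun z \<notin> l1_spectrum catalan"
  then obtain b where b: "b \<in> weighted_l1" and inv: "conv ?a b = delta0"
    by (auto simp: l1_spectrum_def)
  have Sb: "summable (\<lambda>n. norm (b n * z ^ n))"
  proof (rule summable_comparison_test'[of _ 0])
    show "summable (\<lambda>n. cmod (b n) / 4 ^ n)" using b by (simp add: weighted_l1_def)
    show "norm (norm (b n * z ^ n)) \<le> cmod (b n) / 4 ^ n" for n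
      using mult_left_mono[OF power_mono[OF assms norm_ge_zero], of "cmod (b n)" n]
      by (simp add: norm_mult norm_power power_divide)
  qed
  have d: "(\<lambda>n. delta0 n * z ^ n) sums 1"
  proof -
    have "(\<lambda>n. delta0 n * z ^ n) = (\<lambda>n. if n = 0 then z ^ n else 0)"
      by (auto simp: delta0_def)
    then show ?thesis using sums_single[of 0 "\<lambda>n. z ^ n"] by (simp only: power_0)
  qed
  have a: "(\<lambda>n. ?a n * z ^ n) sums 0"
  proof -
    have "(\<lambda>n. catalan_fun z * (delta0 n * z ^ n) - catalan n * z ^ n) sums (catalan_fun z * 1 - catalan_fun z)"
      using summable_sums[OF summable_norm_cancel[OF summable_norm_catalan[OF assms]]]
      unfolding catalan_fun_def[symmetric] by (intro sums_diff sums_mult d)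
    then show ?thesis by (simp add: algebra_simps)
  qed
  \<comment> \<open>From index 1 on \<open>delta0\<close> vanishes and the terms have the norms of
    the Catalan series.\<close>
  have Sa: "summable (\<lambda>n. norm (?a n * z ^ n))"
  proof (rule summable_comparison_test'[of _ 1])
    show "summable (\<lambda>n. norm (catalan n * z ^ n))" by (rule summable_norm_catalan[OF assms])
  qed (simp add: delta0_def)
  have "(\<lambda>n. \<Sum>i\<le>n. (b i * z ^ i) * (?a (n - i) * z ^ (n - i))) sums ((\<Sum>n. b n * z ^ n) * (\<Sum>n. ?a n * z ^ n))"
    by (rule Cauchy_product_sums[OF Sb Sa])
  moreover have "(\<Sum>i\<le>n. (b i * z ^ i) * (?a (n - i) * z ^ (n - i))) = delta0 n * z ^ n" for n
  proof -
    have "(\<Sum>i\<le>n. (b i * z ^ i) * (?a (n - i) * z ^ (n - i))) = (\<Sum>i\<le>n. ?a (n - i) * b i * z ^ n)"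
    proof (intro sum.cong refl)
      fix i assume "i \<in> {..n}"
      then have "z ^ n = z ^ i * z ^ (n - i)" by (simp flip: power_add)
      then show "(b i * z ^ i) * (?a (n - i) * z ^ (n - i)) = ?a (n - i) * b i * z ^ n"
        by (simp add: ac_simps)
    qed
    also have "\<dots> = conv ?a b n * z ^ n" by (simp add: conv_def sum_distrib_right)
    finally show ?thesis by (simp only: inv)
  qed
  ultimately have "1 = (\<Sum>n. b n * z ^ n) * (\<Sum>n. ?a n * z ^ n)"
    using d by (simp add: sums_unique2)
  also have "(\<Sum>n. ?a n * z ^ n) = 0" using a by (rule sums_unique[symmetric])
  finally show False by simp
qed


section \<open>The moments of the Catalan density\<close>

text \<open>The recursion comes from the derivative of \<open>(t - 1/4)^(3/2) / t^(n + 2)\<close>, which combines the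
  integrands of index \<open>n\<close> and \<open>n + 1\<close>.\<close>

primrec catalan_primitive :: "nat \<Rightarrow> real \<Rightarrow> real" where
  "catalan_primitive 0 t = 2 * arctan (2 * sqrt (t - 1/4)) - sqrt (t - 1/4) / t"
| "catalan_primitive (Suc n) t = 4 / real (n + 2) *
     (sqrt (t - 1/4) * (t - 1/4) / t ^ (n + 2) + (real n + 1/2) * catalan_primitive n t)"

lemma DERIV_catalan_primitive:
  assumes t: "t > 1/4"
  shows "(catalan_primitive n has_real_derivative sqrt (t - 1/4) / t ^ (n + 2)) (at t)"
proof (induction n)
  case 0
  define s where "s = sqrt (t - 1/4)"
  have s: "s > 0" "s * s = t - 1/4" using t by (simp_all add: s_def)
  have "(catalan_primitive 0 has_real_derivative
      2 * (inverse (1 + (2 * s)\<^sup>2) * (2 * (inverse s / 2))) - (inverse s / 2 * t - s) / (t * t)) (at t)"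
    unfolding catalan_primitive.simps[abs_def] s_def
    using t by (auto intro!: derivative_eq_intros)
  also have "1 + (2 * s)\<^sup>2 = 4 * t" using s(2) by (simp add: power2_eq_square)
  also have "2 * (inverse (4 * t) * (2 * (inverse s / 2))) - (inverse s / 2 * t - s) / (t * t)
      = s / t ^ (0 + 2)"
    using s(1) t by (simp add: field_simps power2_eq_square)
  finally show ?case by (simp add: s_def)
next
  case (Suc n)
  define s where "s = sqrt (t - 1/4)"
  have s: "s > 0" "s * s = t - 1/4" using t by (simp_all add: s_def)
  have root: "((\<lambda>t. sqrt (t - 1/4) * (t - 1/4)) has_real_derivative inverse s / 2 * (t - 1/4) + s) (at t)"
    using t by (auto intro!: derivative_eq_intros simp: s_def)
  have pow: "((\<lambda>t. t ^ (n + 2)) has_real_derivative real (n + 2) * t ^ (n + 1)) (at t)"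
    using DERIV_pow[of "n + 2" t] by simp
  have "(catalan_primitive (Suc n) has_real_derivative
      4 / real (n + 2) * (((inverse s / 2 * (t - 1/4) + s) * t ^ (n + 2)
        - s * (t - 1/4) * (real (n + 2) * t ^ (n + 1))) / (t ^ (n + 2) * t ^ (n + 2))
        + (real n + 1/2) * (s / t ^ (n + 2)))) (at t)"
    unfolding catalan_primitive.simps(2)[abs_def] s_def
    using t by (intro DERIV_cmult DERIV_add DERIV_divide root[unfolded s_def] pow Suc) simp
  also have "inverse s / 2 * (t - 1/4) + s = 3 / 2 * s"
    using s(1) by (simp add: s(2)[symmetric])
  also have "(3 / 2 * s * t ^ (n + 2) - s * (t - 1/4) * (real (n + 2) * t ^ (n + 1)))
        / (t ^ (n + 2) * t ^ (n + 2)) = s * (3 / 2 * t - (t - 1/4) * real (n + 2)) / t ^ (n + 3)"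
    using t by (simp add: field_simps power_add power3_eq_cube)
  also have "4 / real (n + 2) * (s * (3 / 2 * t - (t - 1/4) * real (n + 2)) / t ^ (n + 3)
        + (real n + 1/2) * (s / t ^ (n + 2))) = s / t ^ (Suc n + 2)"
  proof -
    \<comment> \<open>The terms containing an extra \<open>t\<close> cancel and
      \<open>s * N / 4\<close> remains in the numerator; this is the source of the factor
      \<open>4 / (n + 2)\<close> in the recursion.\<close>
    have key: "4 / N * (s * (3 / 2 * t - (t - 1/4) * N) / t ^ (n + 3) + (N - 3/2) * (s / t ^ (n + 2)))
        = s / t ^ (Suc n + 2)" if "N > 0" for N
      using t that by (simp add: field_simps power_add power3_eq_cube)
    have shift: "real n + 1/2 = real (n + 2) - 3/2" by simp
    show ?thesis unfolding shift by (rule key) simp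
  qed
  finally show ?case by (simp add: s_def)
qed

lemma catalan_primitive_at_quarter: "(catalan_primitive n \<longlongrightarrow> 0) (at_right (1/4))"
proof -
  have "continuous (at_right (1/4)) (catalan_primitive n) \<and> catalan_primitive n (1/4) = 0"
  proof (induction n)
    case 0
    show ?case unfolding catalan_primitive.simps[abs_def] by (auto intro!: continuous_intros)
  next
    case (Suc n)
    then show ?case unfolding catalan_primitive.simps[abs_def] by (auto intro!: continuous_intros)
  qed
  then show ?thesis by (metis continuous_within)
qed

text \<open>At index 0 the arctangent contributes \<open>2 * (pi / 2)\<close>. In the recursion the
  boundary term tends to 0, leaving the factor \<open>4 (n + 1/2) / (n + 2)\<close>, the ratio of
  consecutive Catalan numbers.\<close>

lemma catalan_primitive_at_top:
  "(catalan_primitive n \<longlongrightarrow> pi * cmod (catalan n)) at_top"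
proof (induction n)
  case 0
  have "((\<lambda>t::real. 2 * arctan (2 * sqrt (t - 1/4)) - sqrt (t - 1/4) / t) \<longlongrightarrow> pi) at_top"
    by real_asymp
  then show ?case by (simp add: catalan_def)
next
  case (Suc n)
  have lim: "((\<lambda>t::real. sqrt (t - 1/4) * (t - 1/4) / t ^ (n + 2)) \<longlongrightarrow> 0) at_top"
  proof (rule Lim_null_comparison)
    show "((\<lambda>t::real. sqrt (t - 1/4) * (t - 1/4) / t ^ 2) \<longlongrightarrow> 0) at_top"
      by real_asymp
    have "norm (sqrt (t - 1/4) * (t - 1/4) / t ^ (n + 2)) \<le> sqrt (t - 1/4) * (t - 1/4) / t ^ 2"
      if "t \<ge> 1" for t :: real
    proof -
      have "t ^ 2 \<le> t ^ (n + 2)" using that by (intro power_increasing) auto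
      then show ?thesis using that by (simp add: divide_left_mono)
    qed
    then show "\<forall>\<^sub>F t in at_top. norm (sqrt (t - 1/4) * (t - 1/4) / t ^ (n + 2))
        \<le> sqrt (t - 1/4) * (t - 1/4) / t ^ 2"
      using eventually_ge_at_top[of "1::real"] by (rule eventually_mono[rotated])
  qed
  have rec: "cmod (catalan (Suc n)) = 2 * real (2 * n + 1) / real (n + 2) * cmod (catalan n)"
    by (simp only: catalan_rec norm_mult norm_divide norm_of_nat norm_numeral)
  have val: "pi * cmod (catalan (Suc n)) = 4 / real (n + 2) * (0 + (real n + 1/2) * (pi * cmod (catalan n)))"
    unfolding rec by (simp add: field_simps)
  show ?case unfolding catalan_primitive.simps(2)[abs_def] val
    by (intro tendsto_intros lim Suc)
qed

text \<open>The integrand is nonnegative, so the limits of its primitive at both ends give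
  integrability as well as the value. These integrals are the weights produced by the Neumann series
  of the resolvent.\<close>

lemma has_integral_catalan:
  "((\<lambda>t. sqrt (t - 1/4) / t ^ (n + 2)) has_integral pi * cmod (catalan n)) {1/4<..}"
proof -
  let ?f = "\<lambda>t. sqrt (t - 1/4) / t ^ (n + 2)"
  have F: "DERIV (catalan_primitive n) t :> ?f t" if "ereal (1/4) < ereal t" for t
    using that by (intro DERIV_catalan_primitive) simp
  have c: "isCont ?f t" if "ereal (1/4) < ereal t" for t
    using that by (intro continuous_intros) auto
  have nn: "AE t in lborel. ereal (1/4) < ereal t \<longrightarrow> ereal t < \<infinity> \<longrightarrow> 0 \<le> ?f t"
    by (intro AE_I2) simp
  have A: "((catalan_primitive n \<circ> real_of_ereal) \<longlongrightarrow> 0) (at_right (ereal (1/4)))"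
    by (simp add: ereal_tendsto_simps catalan_primitive_at_quarter)
  have B: "((catalan_primitive n \<circ> real_of_ereal) \<longlongrightarrow> pi * cmod (catalan n)) (at_left \<infinity>)"
    by (simp add: ereal_tendsto_simps catalan_primitive_at_top)
  note FTC = interval_integral_FTC_nonneg[OF _ F c nn A B]
  have S: "einterval (ereal (1/4)) \<infinity> = {1/4<..}" by (auto simp: einterval_def)
  have "set_integrable lborel {1/4<..} ?f" "(LINT t:{1/4<..}|lborel. ?f t) = pi * cmod (catalan n)"
    using FTC by (simp_all add: S interval_lebesgue_integral_def)
  then show ?thesis
    using set_borel_integral_eq_integral[of "{1/4<..}" ?f] by (simp add: has_integral_iff)
qed


section \<open>Bounded complex-linear operators\<close>

text \<open>Absolute convergence makes the double family summable; summing it by rows gives the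
  product of the sums, and by antidiagonals the Cauchy product. The bilinear form covers composition
  of operators.\<close>

lemma Cauchy_product_sums_bilinear:
  fixes f :: "nat \<Rightarrow> 'b::banach" and g :: "nat \<Rightarrow> 'c::banach" and prod :: "'b \<Rightarrow> 'c \<Rightarrow> 'd::banach"
  assumes "bounded_bilinear prod" and f: "summable (\<lambda>n. norm (f n))" and g: "summable (\<lambda>n. norm (g n))"
  shows "(\<lambda>n. \<Sum>i\<le>n. prod (f i) (g (n - i))) sums prod (\<Sum>n. f n) (\<Sum>n. g n)"
proof -
  interpret bounded_bilinear prod by fact
  obtain K where K: "\<And>a b. norm (prod a b) \<le> norm a * norm b * K" using bounded by blast
  let ?h = "\<lambda>(i, j). prod (f i) (g j)"
  have hs: "(f has_sum (\<Sum>n. f n)) UNIV" "(g has_sum (\<Sum>n. g n)) UNIV"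
    using f g by (auto intro!: norm_summable_imp_has_sum summable_sums summable_norm_cancel)
  have hn: "((\<lambda>n. norm (f n)) has_sum (\<Sum>n. norm (f n))) UNIV"
    "((\<lambda>n. norm (g n)) has_sum (\<Sum>n. norm (g n))) UNIV"
    using f g by (auto intro!: norm_summable_imp_has_sum summable_sums)
  have "(\<lambda>(i, j). norm (f i) * norm (g j) * K) summable_on UNIV \<times> UNIV"
  proof -
    have "(\<lambda>(i, j). norm (f i) * norm (g j)) summable_on UNIV \<times> UNIV"
    proof (rule summable_on_SigmaI)
      show "((\<lambda>j. (case (i, j) of (i, j) \<Rightarrow> norm (f i) * norm (g j))) has_sum norm (f i) * (\<Sum>n. norm (g n))) UNIV" for i
        using has_sum_cmult_right[OF hn(2)] by simp
      show "(\<lambda>i. norm (f i) * (\<Sum>n. norm (g n))) summable_on UNIV"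
        using has_sum_cmult_left[OF hn(1)] by (rule has_sum_imp_summable)
    qed simp
    then have "(\<lambda>x. (case x of (i, j) \<Rightarrow> norm (f i) * norm (g j)) * K) summable_on UNIV \<times> UNIV"
      by (rule summable_on_cmult_left)
    then show ?thesis by (simp add: case_prod_unfold)
  qed
  then have "(\<lambda>x. norm (?h x)) summable_on UNIV \<times> UNIV"
    by (rule summable_on_comparison_test) (auto simp: K)
  then have summ: "?h summable_on UNIV \<times> UNIV" by (rule abs_summable_summable)
  have "(?h has_sum prod (\<Sum>n. f n) (\<Sum>n. g n)) (UNIV \<times> UNIV)"
  proof (rule has_sum_SigmaI[OF _ _ summ])
    show "((\<lambda>j. ?h (i, j)) has_sum prod (f i) (\<Sum>n. g n)) UNIV" for i
      using has_sum_bounded_linear[OF bounded_linear_right hs(2)] by simp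
    show "((\<lambda>i. prod (f i) (\<Sum>n. g n)) has_sum prod (\<Sum>n. f n) (\<Sum>n. g n)) UNIV"
      by (rule has_sum_bounded_linear[OF bounded_linear_left hs(1)])
  qed
  also have "(?h has_sum prod (\<Sum>n. f n) (\<Sum>n. g n)) (UNIV \<times> UNIV) \<longleftrightarrow>
      ((\<lambda>(n, i). prod (f i) (g (n - i))) has_sum prod (\<Sum>n. f n) (\<Sum>n. g n)) (SIGMA n:UNIV. {..n})"
    by (rule has_sum_reindex_bij_witness[of _ "\<lambda>(n, i). (i, n - i)" "\<lambda>(i, j). (i + j, i)"]) auto
  finally have "((\<lambda>n. \<Sum>i\<le>n. prod (f i) (g (n - i))) has_sum prod (\<Sum>n. f n) (\<Sum>n. g n)) UNIV"
    by (rule has_sum_SigmaD) (simp add: has_sum_finite)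
  then show ?thesis by (rule has_sum_imp_sums)
qed

section \<open>Algebra and inverses of complex-linear operators\<close>

lemma scaleC_vector_space: "vector_space (scaleC :: complex \<Rightarrow> 'a::complex_normed_vector \<Rightarrow> 'a)"
  by unfold_locales (simp_all add: scaleC_add_right scaleC_add_left scaleC_scaleC scaleC_one)

global_interpretation scaleC: vector_space "scaleC :: complex \<Rightarrow> 'a::complex_normed_vector \<Rightarrow> 'a"
  by (rule scaleC_vector_space)

lemma scaleC_blinfun_apply [simp]: "blinfun_apply (a *\<^sub>C S) x = a *\<^sub>C blinfun_apply S x"
  by transfer simp

lemma blinfun_compose_scaleC_left [simp]: "(a *\<^sub>C S) o\<^sub>L R = a *\<^sub>C (S o\<^sub>L R)"
  by (rule blinfun_eqI) simp

lemma bounded_opsD: "S \<in> bounded_ops \<Longrightarrow> blinfun_apply S (a *\<^sub>C x) = a *\<^sub>C blinfun_apply S x"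
  by (simp add: bounded_ops_def)

lemma blinfun_compose_scaleC_right [simp]:
  "S \<in> bounded_ops \<Longrightarrow> S o\<^sub>L (a *\<^sub>C R) = a *\<^sub>C (S o\<^sub>L R)"
  by (rule blinfun_eqI) (simp add: bounded_opsD)

lemma bounded_ops_simps [simp]:
  "id_blinfun \<in> bounded_ops"
  "R \<in> bounded_ops \<Longrightarrow> S \<in> bounded_ops \<Longrightarrow> R o\<^sub>L S \<in> bounded_ops"
  "R \<in> bounded_ops \<Longrightarrow> S \<in> bounded_ops \<Longrightarrow> R + S \<in> bounded_ops"
  "R \<in> bounded_ops \<Longrightarrow> S \<in> bounded_ops \<Longrightarrow> R - S \<in> bounded_ops"
  "R \<in> bounded_ops \<Longrightarrow> a *\<^sub>C R \<in> bounded_ops"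
  by (simp_all add: bounded_ops_def blinfun.bilinear_simps scaleC_add_right scaleC_scaleC
      scaleC.scale_right_diff_distrib mult.commute)

lemma bounded_ops_power [simp]: "S \<in> bounded_ops \<Longrightarrow> op_power S n \<in> bounded_ops"
  by (induction n) simp_all

lemma bounded_ops_suminf:
  assumes "summable f" and "\<And>n. f n \<in> bounded_ops"
  shows "(\<Sum>n. f n) \<in> bounded_ops"
  unfolding bounded_ops_def
proof (intro CollectI allI)
  fix a x
  have app: "(\<lambda>n. blinfun_apply (f n) y) sums blinfun_apply (\<Sum>n. f n) y" for y
    by (rule bounded_linear.sums[OF blinfun.bounded_linear_left summable_sums[OF assms(1)]])
  have "(\<lambda>n. blinfun_apply (f n) (a *\<^sub>C x)) sums (a *\<^sub>C blinfun_apply (\<Sum>n. f n) x)"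
    using bounded_linear.sums[OF bounded_linear_scaleC app, of a x] by (simp add: bounded_opsD assms(2))
  with app show "blinfun_apply (\<Sum>n. f n) (a *\<^sub>C x) = a *\<^sub>C blinfun_apply (\<Sum>n. f n) x"
    by (rule sums_unique2)
qed

lemma op_power_commute:
  assumes "S o\<^sub>L R = R o\<^sub>L S"
  shows "op_power S n o\<^sub>L R = R o\<^sub>L op_power S n"
proof (induction n)
  case 0
  show ?case by (rule blinfun_eqI) simp
next
  case (Suc n)
  have "S (R x) = R (S x)" "op_power S n (R x) = R (op_power S n x)" for x
    using assms Suc by (metis blinfun_apply_blinfun_compose)+
  then show ?case by (intro blinfun_eqI) simp
qed

lemma op_power_add: "op_power S m o\<^sub>L op_power S n = op_power S (m + n)"
proof (induction m)
  case (Suc m)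
  then have "op_power S m (op_power S n x) = op_power S (m + n) x" for x
    by (metis blinfun_apply_blinfun_compose)
  then show ?case by (intro blinfun_eqI) simp
qed (auto intro!: blinfun_eqI)

lemma op_power_scaleC: "S \<in> bounded_ops \<Longrightarrow> op_power (a *\<^sub>C S) n = a ^ n *\<^sub>C op_power S n"
  by (induction n) (simp_all add: scaleC_one scaleC_scaleC mult.commute)

lemma is_op_inverse_unique:
  assumes "is_op_inverse S R" "is_op_inverse S R'"
  shows "R = R'"
proof (rule blinfun_eqI)
  fix x
  have "R (S (R' x)) = R' x" "S (R' x) = x"
    using assms unfolding is_op_inverse_def
    by (metis blinfun_apply_blinfun_compose blinfun_apply_id_blinfun id_apply)+
  then show "R x = R' x" by simp
qed

lemma resolvent_eqI:
  assumes "is_op_inverse (\<mu> *\<^sub>C id_blinfun - S) R"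
  shows "\<mu> \<in> resolvent_set S" and "resolvent S \<mu> = R"
proof -
  show "\<mu> \<in> resolvent_set S" using assms by (auto simp: resolvent_set_def)
  show "resolvent S \<mu> = R"
    unfolding resolvent_def using assms
  proof (rule the_equality)
    fix R' assume "is_op_inverse (\<mu> *\<^sub>C id_blinfun - S) R'"
    then show "R' = R" using assms by (rule is_op_inverse_unique)
  qed
qed

lemma is_op_inverse_resolvent:
  "\<mu> \<in> resolvent_set S \<Longrightarrow> is_op_inverse (\<mu> *\<^sub>C id_blinfun - S) (resolvent S \<mu>)"
  using resolvent_eqI(2)[of \<mu> S] unfolding resolvent_set_def mem_Collect_eq by metis

lemma is_op_inverse_compose:
  assumes "is_op_inverse A A'" "is_op_inverse B B'"
  shows "is_op_inverse (A o\<^sub>L B) (B' o\<^sub>L A')"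
proof -
  have "A (A' x) = x" "A' (A x) = x" "B (B' x) = x" "B' (B x) = x" for x
    using assms unfolding is_op_inverse_def
    by (metis blinfun_apply_blinfun_compose blinfun_apply_id_blinfun id_apply)+
  with assms show ?thesis
    by (auto simp: is_op_inverse_def intro!: blinfun_eqI)
qed

lemma is_op_inverse_scaleC:
  assumes "is_op_inverse A A'" "A \<in> bounded_ops" "a \<noteq> 0"
  shows "is_op_inverse (a *\<^sub>C A) ((1 / a) *\<^sub>C A')"
  using assms by (simp add: is_op_inverse_def scaleC_scaleC scaleC_one)

text \<open>The growth bound on the powers takes the place of a spectral radius; it is used with
  \<open>r = 1/4\<close> for \<open>T\<close> and with \<open>r = 2\<close> for
  \<open>C(T)\<close>.\<close>

lemma neumann_series_resolvent:
  fixes S :: "'a::cbanach \<Rightarrow>\<^sub>L 'a"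
  assumes S: "S \<in> bounded_ops" and bound: "\<And>n. norm (op_power S n) \<le> K * r ^ n"
    and r: "0 \<le> r" "r < cmod \<mu>"
  shows "summable (\<lambda>n. norm ((1 / \<mu> ^ Suc n) *\<^sub>C op_power S n))"
    and "\<mu> \<in> resolvent_set S"
    and "resolvent S \<mu> = (\<Sum>n. (1 / \<mu> ^ Suc n) *\<^sub>C op_power S n)"
proof -
  let ?f = "\<lambda>n. (1 / \<mu> ^ Suc n) *\<^sub>C op_power S n"
  have \<mu>: "\<mu> \<noteq> 0" using r by auto
  show summ: "summable (\<lambda>n. norm (?f n))"
  proof (rule summable_comparison_test'[of _ 0])
    show "summable (\<lambda>n. K / cmod \<mu> * (r / cmod \<mu>) ^ n)"
      using r by (intro summable_mult summable_geometric) (auto simp: divide_less_eq)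
    show "norm (norm (?f n)) \<le> K / cmod \<mu> * (r / cmod \<mu>) ^ n" for n
      using bound[of n] \<mu>
      by (simp add: norm_scaleC norm_divide norm_mult norm_power power_divide divide_right_mono)
  qed
  note sums = summable_sums[OF summable_norm_cancel[OF summ]]
  define R where "R = (\<Sum>n. ?f n)"
  have RB: "R \<in> bounded_ops"
    unfolding R_def by (intro bounded_ops_suminf summable_norm_cancel[OF summ]) (simp add: S)
  \<comment> \<open>Composition with \<open>S\<close> turns each term into \<open>\<mu>\<close>
    times the next one, so \<open>S R\<close> will be \<open>\<mu> R\<close> less its zeroth term,
    the identity.\<close>
  have shift: "(\<lambda>n. \<mu> *\<^sub>C ?f (Suc n)) sums (\<mu> *\<^sub>C R - id_blinfun)"
  proof -
    have "(\<lambda>n. \<mu> *\<^sub>C ?f n) sums (\<mu> *\<^sub>C R)"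
      unfolding R_def by (rule bounded_linear.sums[OF bounded_linear_scaleC sums])
    then have "(\<lambda>n. \<mu> *\<^sub>C ?f (Suc n)) sums (\<mu> *\<^sub>C R - \<mu> *\<^sub>C ?f 0)"
      by (subst sums_Suc_iff) (simp only: diff_add_cancel)
    then show ?thesis using \<mu> by (simp add: scaleC_scaleC scaleC_one)
  qed
  have step: "S o\<^sub>L ?f n = \<mu> *\<^sub>C ?f (Suc n)" "?f n o\<^sub>L S = \<mu> *\<^sub>C ?f (Suc n)" for n
    using \<mu> op_power_commute[of S S n] by (simp_all add: S scaleC_scaleC)
  have "(\<lambda>n. S o\<^sub>L ?f n) sums (S o\<^sub>L R)" "(\<lambda>n. ?f n o\<^sub>L S) sums (R o\<^sub>L S)"
    unfolding R_def
    by (intro bounded_linear.sums[OF bounded_bilinear.bounded_linear_right[OF bounded_bilinear_blinfun_compose] sums]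
          bounded_linear.sums[OF bounded_bilinear.bounded_linear_left[OF bounded_bilinear_blinfun_compose] sums])+
  then have "S o\<^sub>L R = \<mu> *\<^sub>C R - id_blinfun" "R o\<^sub>L S = \<mu> *\<^sub>C R - id_blinfun"
    using shift sums_unique2 unfolding step by blast+
  then have "S (R x) = \<mu> *\<^sub>C R x - x" "R (S x) = \<mu> *\<^sub>C R x - x" for x
    by (metis blinfun_apply_blinfun_compose blinfun.diff_left scaleC_blinfun_apply blinfun_apply_id_blinfun id_apply)+
  then have "is_op_inverse (\<mu> *\<^sub>C id_blinfun - S) R"
    using RB by (auto simp: is_op_inverse_def blinfun.bilinear_simps bounded_opsD intro!: blinfun_eqI)
  from resolvent_eqI[OF this]
  show "\<mu> \<in> resolvent_set S" "resolvent S \<mu> = (\<Sum>n. ?f n)" by (simp_all add: R_def)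
qed


section \<open>The Catalan generating function of an operator\<close>

lemma catalan_eq_of_real: "catalan n = complex_of_real (cmod (catalan n))"
  by (simp add: catalan_def norm_divide flip: of_nat_Suc)

text \<open>\<open>M\<close> bounds the powers of \<open>4 T\<close>; with \<open>4^n\<close> moved
  to the right the bound has the form \<open>K * r ^ n\<close> of the Neumann series.\<close>

locale quarter_power_bounded =
  fixes T :: "'a::cbanach \<Rightarrow>\<^sub>L 'a" and M :: real
  assumes T: "T \<in> bounded_ops"
    and norm_power: "\<And>n. norm (op_power T n) \<le> M * (1 / 4) ^ n"
begin

section \<open>Convergence, quadratic equation and square root\<close>

lemma M_nonneg: "0 \<le> M"
  using order_trans[OF norm_ge_zero norm_power[of 0]] by simp

lemma summable_norm_catalan_op: "summable (\<lambda>n. norm (catalan n *\<^sub>C op_power T n))"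
proof (rule summable_comparison_test'[of _ 0])
  show "summable (\<lambda>n. M * (cmod (catalan n) / 4 ^ n))"
    by (intro summable_mult summable_catalan_weighted)
  show "norm (norm (catalan n *\<^sub>C op_power T n)) \<le> M * (cmod (catalan n) / 4 ^ n)" for n
    using mult_left_mono[OF norm_power[of n], of "cmod (catalan n)"]
    by (simp add: norm_scaleC power_divide mult.commute)
qed

lemmas summable_catalan_op = summable_norm_cancel[OF summable_norm_catalan_op]

lemma catalan_op_sums: "(\<lambda>n. catalan n *\<^sub>C op_power T n) sums catalan_op T"
  unfolding catalan_op_def by (rule summable_sums[OF summable_catalan_op])

lemma catalan_op_bounded [simp]: "catalan_op T \<in> bounded_ops"
  unfolding catalan_op_def by (intro bounded_ops_suminf summable_catalan_op) (simp add: T)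

lemma T_catalan_op_sums: "(\<lambda>n. catalan n *\<^sub>C op_power T (Suc n)) sums (T o\<^sub>L catalan_op T)"
  using bounded_linear.sums[OF bounded_bilinear.bounded_linear_right[OF bounded_bilinear_blinfun_compose] catalan_op_sums, of T]
  by (simp add: T)

lemma T_catalan_op_commute: "T o\<^sub>L catalan_op T = catalan_op T o\<^sub>L T"
proof (rule sums_unique2[OF T_catalan_op_sums])
  show "(\<lambda>n. catalan n *\<^sub>C op_power T (Suc n)) sums (catalan_op T o\<^sub>L T)"
    using bounded_linear.sums[OF bounded_bilinear.bounded_linear_left[OF bounded_bilinear_blinfun_compose] catalan_op_sums, of T]
    by (simp add: T op_power_commute)
qed

text \<open>The Cauchy product of the series with itself involves only powers of \<open>T\<close>,
  so the scalar argument based on \<open>catalan_convolution\<close> carries over.\<close>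

lemma T_catalan_op_squared: "T o\<^sub>L (catalan_op T o\<^sub>L catalan_op T) = catalan_op T - id_blinfun"
proof -
  let ?f = "\<lambda>n. catalan n *\<^sub>C op_power T n"
  have "(\<lambda>n. \<Sum>i\<le>n. ?f i o\<^sub>L ?f (n - i)) sums (catalan_op T o\<^sub>L catalan_op T)"
    unfolding catalan_op_def
    by (rule Cauchy_product_sums_bilinear[OF bounded_bilinear_blinfun_compose
          summable_norm_catalan_op summable_norm_catalan_op])
  moreover have "(\<Sum>i\<le>n. ?f i o\<^sub>L ?f (n - i)) = catalan (Suc n) *\<^sub>C op_power T n" for n
  proof -
    have "(\<Sum>i\<le>n. ?f i o\<^sub>L ?f (n - i)) = (\<Sum>i\<le>n. (catalan i * catalan (n - i)) *\<^sub>C op_power T n)"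
      by (intro sum.cong refl) (simp add: T op_power_add scaleC_scaleC)
    then show ?thesis by (simp only: scaleC.scale_sum_left[symmetric] catalan_convolution)
  qed
  ultimately have "(\<lambda>n. catalan (Suc n) *\<^sub>C op_power T n) sums (catalan_op T o\<^sub>L catalan_op T)"
    by simp
  from bounded_linear.sums[OF bounded_bilinear.bounded_linear_right[OF bounded_bilinear_blinfun_compose] this, of T]
  have "(\<lambda>n. ?f (Suc n)) sums (T o\<^sub>L (catalan_op T o\<^sub>L catalan_op T))"
    by (simp add: T)
  moreover have "(\<lambda>n. ?f (Suc n)) sums (catalan_op T - ?f 0)"
    using catalan_op_sums by (subst sums_Suc_iff) (simp only: diff_add_cancel)
  ultimately show ?thesis
    by (auto simp: catalan_def scaleC_one dest: sums_unique2)
qed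

lemma catalan_op_commute_apply: "T (catalan_op T x) = catalan_op T (T x)"
  using T_catalan_op_commute by (metis blinfun_apply_blinfun_compose)

lemma T_catalan_op_squared_apply: "T (catalan_op T (catalan_op T x)) = catalan_op T x - x"
  using arg_cong[OF T_catalan_op_squared, of "\<lambda>S. blinfun_apply S x"] by (simp add: blinfun.diff_left)

text \<open>Term \<open>n + 1\<close> of the binomial series is \<open>-2 C_n T^(n+1)\<close>,
  whence \<open>sqrt (1 - 4T) = 1 - 2 T C(T)\<close>.\<close>

lemma T_catalan_op_eq_sqrt: "T o\<^sub>L catalan_op T = (1 / 2) *\<^sub>C id_blinfun - sqrt_quarter_minus T"
proof -
  let ?s = "\<lambda>n. ((- 4) ^ n * ((1 / 2) gchoose n)) *\<^sub>C op_power T n"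
  have "(\<lambda>n. (- 2) *\<^sub>C (catalan n *\<^sub>C op_power T (Suc n))) sums ((- 2) *\<^sub>C (T o\<^sub>L catalan_op T))"
    by (rule bounded_linear.sums[OF bounded_linear_scaleC T_catalan_op_sums])
  then have "(\<lambda>n. ?s (Suc n)) sums ((- 2) *\<^sub>C (T o\<^sub>L catalan_op T))"
    by (simp only: catalan_eq_gbinomial scaleC_scaleC)
  then have "?s sums ((- 2) *\<^sub>C (T o\<^sub>L catalan_op T) + ?s 0)"
    by (subst (asm) sums_Suc_iff)
  then have "sqrt_one_minus_four T = (- 2) *\<^sub>C (T o\<^sub>L catalan_op T) + id_blinfun"
    unfolding sqrt_one_minus_four_def by (simp add: sums_iff scaleC_one)
  then show ?thesis
    by (simp add: sqrt_quarter_minus_def scaleC.scale_right_diff_distrib scaleC_scaleC scaleC_one)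
qed

text \<open>Only the bound \<open>\<Sum> C\<^sub>n / 4^n \<le> 2\<close> enters; carrying the factor \<open>T^m\<close> along makes the
  induction on \<open>k\<close> work without expanding the powers of the series.\<close>

lemma norm_catalan_op_power_T:
  "norm (op_power (catalan_op T) k o\<^sub>L op_power T m) \<le> M * 2 ^ k * (1 / 4) ^ m"
proof (induction k arbitrary: m)
  case 0
  have "id_blinfun o\<^sub>L op_power T m = op_power T m" by (rule blinfun_eqI) simp
  then show ?case using norm_power by simp
next
  case (Suc k)
  let ?Yk = "op_power (catalan_op T) k"
  let ?f = "\<lambda>n. catalan n *\<^sub>C (?Yk o\<^sub>L op_power T (n + m))"
  have Yk: "catalan_op T o\<^sub>L ?Yk = ?Yk o\<^sub>L catalan_op T"
    by (rule op_power_commute[symmetric]) simp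
  \<comment> \<open>Only the new factor \<open>C(T)\<close>, moved next to \<open>T^m\<close>, is
    expanded; its n-th term meets the induction hypothesis at exponent \<open>n + m\<close>.\<close>
  have "bounded_linear (\<lambda>S. ?Yk o\<^sub>L (S o\<^sub>L op_power T m))"
    by (intro bounded_linear_intros bounded_linear_ident)
  from bounded_linear.sums[OF this catalan_op_sums]
  have sums: "?f sums (?Yk o\<^sub>L (catalan_op T o\<^sub>L op_power T m))"
    by (simp add: op_power_add)
  have le: "norm (?f n) \<le> M * 2 ^ k * (1 / 4) ^ m * (cmod (catalan n) / 4 ^ n)" for n
    using mult_left_mono[OF Suc.IH[of "n + m"], of "cmod (catalan n)"]
    by (simp add: norm_scaleC power_add power_divide mult_ac)
  have summ: "summable (\<lambda>n. M * 2 ^ k * (1 / 4) ^ m * (cmod (catalan n) / 4 ^ n))"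
    by (intro summable_mult summable_catalan_weighted)
  have summ': "summable (\<lambda>n. norm (?f n))"
    by (rule summable_comparison_test'[OF summ, of 0]) (use le in simp)
  have "op_power (catalan_op T) (Suc k) o\<^sub>L op_power T m = ?Yk o\<^sub>L (catalan_op T o\<^sub>L op_power T m)"
    unfolding op_power.simps Yk by (rule blinfun_eqI) simp
  also have "\<dots> = (\<Sum>n. ?f n)" using sums by (rule sums_unique)
  also have "norm \<dots> \<le> (\<Sum>n. norm (?f n))" by (rule summable_norm[OF summ'])
  also have "\<dots> \<le> (\<Sum>n. M * 2 ^ k * (1 / 4) ^ m * (cmod (catalan n) / 4 ^ n))"
    by (rule suminf_le[OF le summ' summ])
  also have "\<dots> = M * 2 ^ k * (1 / 4) ^ m * (\<Sum>n. cmod (catalan n) / 4 ^ n)"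
    by (rule suminf_mult[OF summable_catalan_weighted])
  also have "\<dots> \<le> M * 2 ^ k * (1 / 4) ^ m * 2"
    using M_nonneg by (intro mult_left_mono catalan_weighted_sum_le) simp
  finally show ?case by (simp add: mult_ac)
qed

lemma norm_catalan_op_power: "norm (op_power (catalan_op T) k) \<le> M * 2 ^ k"
proof -
  have "op_power (catalan_op T) k o\<^sub>L id_blinfun = op_power (catalan_op T) k" by (rule blinfun_eqI) simp
  then show ?thesis using norm_catalan_op_power_T[of k 0] by simp
qed

section \<open>Spectral bounds and the resolvent of \<open>C(T)\<close>\<close>

lemma spectrum_T_le: "z \<in> op_spectrum T \<Longrightarrow> cmod z \<le> 1 / 4"
  using neumann_series_resolvent(2)[OF T norm_power, of z] by (auto simp: op_spectrum_def not_le[symmetric])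

lemma spectrum_catalan_op_le: "l \<in> op_spectrum (catalan_op T) \<Longrightarrow> cmod l \<le> 2"
  using neumann_series_resolvent(2)[OF catalan_op_bounded norm_catalan_op_power, of l]
  by (auto simp: op_spectrum_def not_le[symmetric])

text \<open>With \<open>m = 1 / l\<close> and \<open>z = m - m\<^sup>2\<close> this is the factorisation
  \<open>z - T = m\<^sup>2 (l - C(T)) (1 - T (l + C(T)))\<close>, the difference of the quadratic equations
  satisfied by \<open>l\<close> and \<open>C(T)\<close>.\<close>

lemma is_op_inverse_catalan_op:
  assumes l: "l \<noteq> 0" and z: "(l - 1) / l\<^sup>2 \<in> resolvent_set T"
  shows "is_op_inverse (l *\<^sub>C id_blinfun - catalan_op T)
    ((1 / l) *\<^sub>C id_blinfun
         + (1 / l ^ 3) *\<^sub>C resolvent T ((l - 1) / l\<^sup>2)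
         + (1 / l\<^sup>2) *\<^sub>C catalan_op T
         - ((l - 1) / l ^ 4) *\<^sub>C (catalan_op T o\<^sub>L resolvent T ((l - 1) / l\<^sup>2)))"
proof -
  define m where "m = 1 / l"
  define R where "R = resolvent T ((l - 1) / l\<^sup>2)"
  let ?Y = "catalan_op T"
  have lm: "l * m = 1" "l * m ^ 3 = m\<^sup>2" "l * m\<^sup>2 = m" "l * (m ^ 3 - m ^ 4) = m\<^sup>2 - m ^ 3"
    "m\<^sup>2 * (m - m\<^sup>2) = m ^ 3 - m ^ 4"
    using l by (simp_all add: m_def field_simps eval_nat_numeral)
  have coeffs: "(l - 1) / l\<^sup>2 = m - m\<^sup>2" "1 / l = m" "1 / l ^ 3 = m ^ 3" "1 / l\<^sup>2 = m\<^sup>2"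
    "(l - 1) / l ^ 4 = m ^ 3 - m ^ 4"
    using l by (simp_all add: m_def field_simps eval_nat_numeral)
  have inv: "is_op_inverse ((m - m\<^sup>2) *\<^sub>C id_blinfun - T) R"
    using is_op_inverse_resolvent[OF z] by (simp only: R_def coeffs)
  then have RB: "R \<in> bounded_ops"
    and TR: "(m - m\<^sup>2) *\<^sub>C R x - T (R x) = x" and RT: "R ((m - m\<^sup>2) *\<^sub>C x - T x) = x" for x
    unfolding is_op_inverse_def
    by (metis blinfun_apply_blinfun_compose blinfun.diff_left scaleC_blinfun_apply blinfun_apply_id_blinfun id_apply)+
  \<comment> \<open>Apply \<open>C(T)\<close> to \<open>x = (m - m^2 - T) R x\<close>, then
    \<open>R\<close> to both sides.\<close>
  have RY: "R (?Y x) = ?Y (R x)" for x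
  proof -
    have "?Y x = (m - m\<^sup>2) *\<^sub>C ?Y (R x) - T (?Y (R x))"
      using arg_cong[OF TR[of x], of "blinfun_apply ?Y"]
      by (simp add: blinfun.diff_right bounded_opsD catalan_op_commute_apply)
    then show ?thesis by (simp add: RT)
  qed
  \<comment> \<open>The same identity under \<open>C(T)^2\<close>; the quadratic equation then
    eliminates \<open>T\<close>.\<close>
  have YY: "?Y (?Y x) = (m - m\<^sup>2) *\<^sub>C ?Y (?Y (R x)) - ?Y (R x) + R x" for x
  proof -
    have "?Y (?Y x) = (m - m\<^sup>2) *\<^sub>C ?Y (?Y (R x)) - T (?Y (?Y (R x)))"
      using arg_cong[OF TR[of x], of "\<lambda>x. ?Y (?Y x)"]
      by (simp add: blinfun.diff_right bounded_opsD catalan_op_commute_apply)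
    then show ?thesis by (simp add: T_catalan_op_squared_apply)
  qed
  \<comment> \<open>This is \<open>m^2 (1 - T (l + C(T))) R\<close> from the factorisation, with
    \<open>T R = (m - m^2) R - 1\<close> used to remove \<open>T\<close>.\<close>
  let ?E = "m *\<^sub>C id_blinfun + m ^ 3 *\<^sub>C R + m\<^sup>2 *\<^sub>C ?Y - (m ^ 3 - m ^ 4) *\<^sub>C (?Y o\<^sub>L R)"
  have E_apply: "?E y = m *\<^sub>C y + m ^ 3 *\<^sub>C R y + m\<^sup>2 *\<^sub>C ?Y y - (m ^ 3 - m ^ 4) *\<^sub>C ?Y (R y)" for y
    by (simp only: blinfun.add_left blinfun.diff_left scaleC_blinfun_apply blinfun_apply_id_blinfun id_apply
        blinfun_apply_blinfun_compose)
  have Y_E_apply: "?Y (?E y) = m *\<^sub>C ?Y y + m ^ 3 *\<^sub>C ?Y (R y) + m\<^sup>2 *\<^sub>C ?Y (?Y y)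
      - (m ^ 3 - m ^ 4) *\<^sub>C ?Y (?Y (R y))" for y
    by (simp only: E_apply blinfun.add_right blinfun.diff_right bounded_opsD[OF catalan_op_bounded])
  have E: "l *\<^sub>C ?E x - ?Y (?E x) = x" for x
  proof -
    have "l *\<^sub>C ?E x - ?Y (?E x)
      = l *\<^sub>C (m *\<^sub>C x + m ^ 3 *\<^sub>C R x + m\<^sup>2 *\<^sub>C ?Y x - (m ^ 3 - m ^ 4) *\<^sub>C ?Y (R x))
        - (m *\<^sub>C ?Y x + m ^ 3 *\<^sub>C ?Y (R x) + m\<^sup>2 *\<^sub>C ?Y (?Y x) - (m ^ 3 - m ^ 4) *\<^sub>C ?Y (?Y (R x)))"
      by (simp only: Y_E_apply) (simp only: E_apply)
    also have "\<dots> = (x + m\<^sup>2 *\<^sub>C R x + m *\<^sub>C ?Y x - (m\<^sup>2 - m ^ 3) *\<^sub>C ?Y (R x))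
        - (m *\<^sub>C ?Y x + m ^ 3 *\<^sub>C ?Y (R x)
          + ((m ^ 3 - m ^ 4) *\<^sub>C ?Y (?Y (R x)) - m\<^sup>2 *\<^sub>C ?Y (R x) + m\<^sup>2 *\<^sub>C R x)
          - (m ^ 3 - m ^ 4) *\<^sub>C ?Y (?Y (R x)))"
      unfolding YY[of x] scaleC.scale_right_distrib scaleC.scale_right_diff_distrib scaleC_scaleC lm scaleC_one ..
    also have "\<dots> = x"
      by (simp add: scaleC.scale_left_diff_distrib)
    finally show ?thesis .
  qed
  have comm: "?Y (?E x) = ?E (?Y x)" for x
    by (simp only: Y_E_apply) (simp only: E_apply RY)
  have EB: "?E \<in> bounded_ops" by (simp add: RB)
  \<comment> \<open>A right inverse of \<open>l - C(T)\<close> that commutes with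
    \<open>C(T)\<close> is also a left inverse.\<close>
  have right_inverse_commuting: "is_op_inverse (l *\<^sub>C id_blinfun - ?Y) F"
    if F: "F \<in> bounded_ops" "\<And>x. l *\<^sub>C F x - ?Y (F x) = x" "\<And>x. ?Y (F x) = F (?Y x)" for F
    unfolding is_op_inverse_def
    using F by (auto simp: blinfun.diff_left blinfun.diff_right bounded_opsD intro!: blinfun_eqI)
  have "is_op_inverse (l *\<^sub>C id_blinfun - ?Y) ?E"
    by (rule right_inverse_commuting[OF EB E comm])
  then show ?thesis by (simp only: R_def coeffs)
qed

section \<open>The spectral mapping theorem\<close>

lemma is_op_inverse_one_minus_T_catalan_op: "is_op_inverse (id_blinfun - (T o\<^sub>L catalan_op T)) (catalan_op T)"
  by (auto simp: is_op_inverse_def blinfun.bilinear_simps T_catalan_op_squared_apply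
      catalan_op_commute_apply[symmetric] intro!: blinfun_eqI)

text \<open>The quadratic equation reads \<open>(1 - T C(T)) C(T) = 1\<close>. Hence a spectral
  value \<open>l\<close> of \<open>C(T)\<close> is nonzero and may be put into
  \<open>(l - 1) / l^2\<close>.\<close>

lemma zero_in_resolvent_set_catalan_op: "0 \<in> resolvent_set (catalan_op T)"
proof (rule resolvent_eqI(1))
  show "is_op_inverse (0 *\<^sub>C id_blinfun - catalan_op T) ((T o\<^sub>L catalan_op T) - id_blinfun)"
    by (auto simp: is_op_inverse_def T blinfun.bilinear_simps T_catalan_op_squared_apply
      catalan_op_commute_apply[symmetric] intro!: blinfun_eqI)
qed

text \<open>Inverting \<open>z = (w - 1) / w\<^sup>2\<close>: for \<open>z = (l - 1) / l\<^sup>2\<close> one has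
  \<open>l\<^sup>2 (z - T) = (l - C(T)) (l - (l - 1) C(T)) C(T)\<^sup>-\<^sup>2\<close>, where \<open>l / (l - 1)\<close> is the second root of
  \<open>z w\<^sup>2 - w + 1\<close>.\<close>

lemma resolvent_set_T_if_roots:
  assumes l: "l \<noteq> 0" "l \<in> resolvent_set (catalan_op T)"
    and l': "l \<noteq> 1 \<Longrightarrow> l / (l - 1) \<in> resolvent_set (catalan_op T)"
  shows "(l - 1) / l\<^sup>2 \<in> resolvent_set T"
proof -
  let ?Y = "catalan_op T"
  define V where "V = id_blinfun - (T o\<^sub>L ?Y)"
  let ?P = "l *\<^sub>C id_blinfun - ?Y" and ?Q = "l *\<^sub>C id_blinfun - (l - 1) *\<^sub>C ?Y"
  have V: "is_op_inverse V ?Y" unfolding V_def by (rule is_op_inverse_one_minus_T_catalan_op)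
  have P: "is_op_inverse ?P (resolvent ?Y l)" by (rule is_op_inverse_resolvent[OF l(2)])
  \<comment> \<open>For \<open>l = 1\<close> there is no second root and the factor is the identity;
    otherwise it is \<open>(l - 1) (l / (l - 1) - C(T))\<close>.\<close>
  obtain Q' where Q: "is_op_inverse ?Q Q'"
  proof (cases "l = 1")
    case True
    have "is_op_inverse ?Q id_blinfun"
      using True by (auto simp: is_op_inverse_def scaleC_one intro!: blinfun_eqI)
    then show ?thesis by (rule that)
  next
    case False
    have "?Q = (l - 1) *\<^sub>C ((l / (l - 1)) *\<^sub>C id_blinfun - ?Y)"
      using False by (simp add: scaleC.scale_right_diff_distrib scaleC_scaleC)
    then have "is_op_inverse ?Q ((1 / (l - 1)) *\<^sub>C resolvent ?Y (l / (l - 1)))"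
      using is_op_inverse_scaleC[OF is_op_inverse_resolvent[OF l'], of "l - 1"] False by simp
    then show ?thesis by (rule that)
  qed
  have "is_op_inverse (?P o\<^sub>L (?Q o\<^sub>L (V o\<^sub>L V))) (((?Y o\<^sub>L ?Y) o\<^sub>L Q') o\<^sub>L resolvent ?Y l)"
    by (intro is_op_inverse_compose P Q V)
  moreover have "?P o\<^sub>L (?Q o\<^sub>L (V o\<^sub>L V)) = l\<^sup>2 *\<^sub>C (((l - 1) / l\<^sup>2) *\<^sub>C id_blinfun - T)"
  proof (rule blinfun_eqI)
    fix x
    have YV: "?Y (V y) = y" for y
      using V unfolding is_op_inverse_def
      by (metis blinfun_apply_blinfun_compose blinfun_apply_id_blinfun id_apply)
    \<comment> \<open>As \<open>V\<close> inverts \<open>C(T)\<close>, its definition evaluated at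
      \<open>V x\<close> gives \<open>V^2 = V - T\<close>; with this the product collapses to
      \<open>(l - 1) - l^2 T\<close>.\<close>
    have VV: "V (V x) = V x - T x"
      using YV[of x] by (simp add: V_def blinfun.diff_left)
    have "(?P o\<^sub>L (?Q o\<^sub>L (V o\<^sub>L V))) x
        = l *\<^sub>C (l *\<^sub>C V (V x) - (l - 1) *\<^sub>C V x) - (l *\<^sub>C V x - (l - 1) *\<^sub>C x)"
      by (simp add: blinfun.bilinear_simps bounded_opsD YV scaleC.scale_right_diff_distrib scaleC_scaleC)
    also have "\<dots> = (l - 1) *\<^sub>C x - l\<^sup>2 *\<^sub>C T x"
      unfolding VV by (simp add: scaleC.scale_right_diff_distrib scaleC.scale_left_diff_distrib
          scaleC_scaleC scaleC_one power2_eq_square algebra_simps)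
    also have "\<dots> = (l\<^sup>2 *\<^sub>C (((l - 1) / l\<^sup>2) *\<^sub>C id_blinfun - T)) x"
      using l(1) by (simp add: blinfun.diff_left scaleC.scale_right_diff_distrib scaleC_scaleC)
    finally show "(?P o\<^sub>L (?Q o\<^sub>L (V o\<^sub>L V))) x = (l\<^sup>2 *\<^sub>C (((l - 1) / l\<^sup>2) *\<^sub>C id_blinfun - T)) x" .
  qed
  ultimately obtain W where W: "is_op_inverse (l\<^sup>2 *\<^sub>C (((l - 1) / l\<^sup>2) *\<^sub>C id_blinfun - T)) W"
    by auto
  have "is_op_inverse ((1 / l\<^sup>2) *\<^sub>C (l\<^sup>2 *\<^sub>C (((l - 1) / l\<^sup>2) *\<^sub>C id_blinfun - T))) ((1 / (1 / l\<^sup>2)) *\<^sub>C W)"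
    by (rule is_op_inverse_scaleC[OF W]) (use l(1) T in simp_all)
  then have "is_op_inverse (((l - 1) / l\<^sup>2) *\<^sub>C id_blinfun - T) (l\<^sup>2 *\<^sub>C W)"
    using l(1) by (simp add: scaleC_scaleC scaleC_one)
  then show ?thesis by (rule resolvent_eqI(1))
qed

lemma quadratic_root_iff:
  fixes l z :: complex
  shows "z * l\<^sup>2 - l + 1 = 0 \<longleftrightarrow> l \<noteq> 0 \<and> z = (l - 1) / l\<^sup>2"
proof
  assume root: "z * l\<^sup>2 - l + 1 = 0"
  then have "l \<noteq> 0" by auto
  moreover have "z * l\<^sup>2 = l - 1" using root by (simp add: algebra_simps)
  ultimately show "l \<noteq> 0 \<and> z = (l - 1) / l\<^sup>2" by (simp add: eq_divide_eq)
qed auto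

text \<open>For a spectral value \<open>l\<close> of \<open>C(T)\<close>,
  \<open>z = (l - 1) / l^2\<close> lies in the spectrum of \<open>T\<close>, as otherwise the
  resolvent formula would invert \<open>l - C(T)\<close>; having modulus at most 2, \<open>l\<close>
  is the root \<open>C(z)\<close>. Conversely, suppose \<open>l = C(z)\<close> were a regular value
  of \<open>C(T)\<close>. The other root would be regular too, since as a spectral value it would
  have modulus at most 2 and equal \<open>l\<close>. Then \<open>z\<close> would be regular for
  \<open>T\<close>.\<close>

lemma spectrum_catalan_op: "op_spectrum (catalan_op T) = catalan_fun ` op_spectrum T"
proof (intro equalityI subsetI)
  fix l assume l: "l \<in> op_spectrum (catalan_op T)"
  then have l0: "l \<noteq> 0" using zero_in_resolvent_set_catalan_op by (auto simp: op_spectrum_def)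
  define z where "z = (l - 1) / l\<^sup>2"
  have z: "z \<in> op_spectrum T"
    using l resolvent_eqI(1)[OF is_op_inverse_catalan_op[OF l0]] by (auto simp: op_spectrum_def z_def)
  have "z * l\<^sup>2 - l + 1 = 0" using l0 by (subst quadratic_root_iff) (simp add: z_def)
  then have "l = catalan_fun z"
    by (rule catalan_fun_unique[OF spectrum_T_le[OF z] _ spectrum_catalan_op_le[OF l]])
  with z show "l \<in> catalan_fun ` op_spectrum T" by blast
next
  fix l assume "l \<in> catalan_fun ` op_spectrum T"
  then obtain z where z: "z \<in> op_spectrum T" and l: "l = catalan_fun z" by blast
  have "z * l\<^sup>2 - l + 1 = 0" unfolding l by (rule catalan_fun_quadratic[OF spectrum_T_le[OF z]])
  then have l0: "l \<noteq> 0" and z_eq: "z = (l - 1) / l\<^sup>2" by (auto simp only: quadratic_root_iff)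
  show "l \<in> op_spectrum (catalan_op T)"
  proof (rule ccontr)
    assume "l \<notin> op_spectrum (catalan_op T)"
    then have lr: "l \<in> resolvent_set (catalan_op T)" by (simp add: op_spectrum_def)
    have "l / (l - 1) \<in> resolvent_set (catalan_op T)" if "l \<noteq> 1"
    proof (rule ccontr)
      assume "l / (l - 1) \<notin> resolvent_set (catalan_op T)"
      then have *: "l / (l - 1) \<in> op_spectrum (catalan_op T)" by (simp add: op_spectrum_def)
      have "z * (l / (l - 1))\<^sup>2 - l / (l - 1) + 1 = 0"
        using l0 that unfolding z_eq by (simp add: power2_eq_square divide_simps)
      then have "l / (l - 1) = l"
        unfolding l by (rule catalan_fun_unique[OF spectrum_T_le[OF z] _ spectrum_catalan_op_le[OF *[unfolded l]]])
      with * lr show False by (simp add: op_spectrum_def)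
    qed
    then have "z \<in> resolvent_set T" unfolding z_eq by (rule resolvent_set_T_if_roots[OF l0 lr])
    with z show False by (simp add: op_spectrum_def)
  qed
qed

section \<open>The integral representation\<close>

lemma resolvent_apply_suminf:
  assumes t: "t > 1/4"
  shows "summable (\<lambda>n. norm ((sqrt (t - 1/4) / t ^ (n + 2)) *\<^sub>R op_power T n x))"
    and "(sqrt (t - 1/4) / t) *\<^sub>R resolvent T (of_real t) x
      = (\<Sum>n. (sqrt (t - 1/4) / t ^ (n + 2)) *\<^sub>R op_power T n x)"
proof -
  let ?g = "\<lambda>n. (1 / complex_of_real t ^ Suc n) *\<^sub>C op_power T n"
  let ?k = "sqrt (t - 1/4) / t"
  note N = neumann_series_resolvent[OF T norm_power, of "complex_of_real t"]
  have summ: "summable (\<lambda>n. norm (?g n))" and R: "resolvent T (of_real t) = (\<Sum>n. ?g n)"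
    using t by (intro N; simp)+
  have eq: "?k *\<^sub>R ?g n x = (sqrt (t - 1/4) / t ^ (n + 2)) *\<^sub>R op_power T n x" for n
    by (simp add: scaleR_scaleC scaleC_scaleC)
  have "summable (\<lambda>n. \<bar>?k\<bar> * (norm (?g n) * norm x))"
    using summ by (intro summable_mult summable_mult2)
  then show "summable (\<lambda>n. norm ((sqrt (t - 1/4) / t ^ (n + 2)) *\<^sub>R op_power T n x))"
  proof (rule summable_comparison_test'[of _ 0])
    show "norm (norm ((sqrt (t - 1/4) / t ^ (n + 2)) *\<^sub>R op_power T n x)) \<le> \<bar>?k\<bar> * (norm (?g n) * norm x)" for n
      unfolding eq[symmetric] norm_scaleR real_norm_def abs_mult abs_abs abs_norm_cancel
      by (intro mult_left_mono norm_blinfun) simp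
  qed
  have "bounded_linear (\<lambda>S. ?k *\<^sub>R blinfun_apply S x)"
    by (intro bounded_linear_intros bounded_linear_ident)
  from bounded_linear.suminf[OF this summable_norm_cancel[OF summ]]
  show "?k *\<^sub>R resolvent T (of_real t) x = (\<Sum>n. (sqrt (t - 1/4) / t ^ (n + 2)) *\<^sub>R op_power T n x)"
    by (simp only: R eq)
qed

text \<open>The Neumann series is integrated termwise: by \<open>has_integral_catalan\<close> its
  n-th term yields \<open>pi C_n T^n x\<close>, and the norms of these vectors are summable.\<close>

lemma catalan_op_integral:
  fixes x :: 'a
  defines "h \<equiv> \<lambda>t. (sqrt (t - 1/4) / t) *\<^sub>R resolvent T (of_real t) x"
  shows "norm_integrable_on h {1/4<..}"
    and "catalan_op T x = (1 / pi) *\<^sub>R integral {1/4<..} h"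
proof -
  let ?f = "\<lambda>n t. (sqrt (t - 1/4) / t ^ (n + 2)) *\<^sub>R op_power T n x"
  have f: "(?f n has_integral pi *\<^sub>R (catalan n *\<^sub>C op_power T n x)) {1/4<..}" for n
  proof -
    have "catalan n *\<^sub>C op_power T n x = cmod (catalan n) *\<^sub>R op_power T n x"
      by (subst catalan_eq_of_real) (simp only: scaleR_scaleC)
    then show ?thesis
      using has_integral_scaleR_left[OF has_integral_catalan[of n], of "op_power T n x"] by simp
  qed
  have nf: "((\<lambda>t. norm (?f n t)) has_integral pi * norm (catalan n *\<^sub>C op_power T n x)) {1/4<..}" for n
  proof -
    have "((\<lambda>t. norm (?f n t)) has_integral pi * cmod (catalan n) * norm (op_power T n x)) {1/4<..}"
      by (rule has_integral_eq[OF _ has_integral_mult_left[OF has_integral_catalan]]) simp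
    then show ?thesis by (simp add: norm_scaleC mult.assoc)
  qed
  have J: "summable (\<lambda>n. pi * norm (catalan n *\<^sub>C op_power T n x))"
  proof (rule summable_mult, rule summable_comparison_test'[of _ 0])
    show "summable (\<lambda>n. norm (catalan n *\<^sub>C op_power T n) * norm x)"
      by (intro summable_mult2 summable_norm_catalan_op)
    show "norm (norm (catalan n *\<^sub>C op_power T n x)) \<le> norm (catalan n *\<^sub>C op_power T n) * norm x" for n
      using norm_blinfun[of "catalan n *\<^sub>C op_power T n" x] by simp
  qed
  have pw: "summable (\<lambda>n. norm (?f n t))" and h: "h t = (\<Sum>n. ?f n t)" if "t \<in> {1/4<..}" for t
    using that unfolding h_def by (simp_all only: resolvent_apply_suminf greaterThan_iff)
  note series = has_integral_suminf[OF f nf J pw]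
  have "(h has_integral (\<Sum>n. pi *\<^sub>R (catalan n *\<^sub>C op_power T n x))) {1/4<..}"
    by (rule has_integral_eq[OF h[symmetric] series(1)])
  moreover have "(\<lambda>n. pi *\<^sub>R (catalan n *\<^sub>C op_power T n x)) sums (pi *\<^sub>R catalan_op T x)"
  proof -
    have "bounded_linear (\<lambda>S. pi *\<^sub>R blinfun_apply S x)"
      by (intro bounded_linear_intros bounded_linear_ident)
    from bounded_linear.sums[OF this catalan_op_sums] show ?thesis by simp
  qed
  ultimately have int: "(h has_integral pi *\<^sub>R catalan_op T x) {1/4<..}"
    by (simp add: sums_iff)
  then show "catalan_op T x = (1 / pi) *\<^sub>R integral {1/4<..} h"
    by (simp add: integral_unique)
  \<comment> \<open>The norm is measurable as a pointwise limit of norms of continuous partial sums;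
    the series of norms is the majorant.\<close>
  have "(\<lambda>t. norm (h t)) integrable_on {1/4<..}"
  proof (rule measurable_bounded_by_integrable_imp_integrable[OF _ series(2)])
    show "(\<lambda>t. norm (h t)) \<in> borel_measurable (lebesgue_on {1/4<..})"
    proof (rule borel_measurable_LIMSEQ_real)
      show "(\<lambda>N. norm (\<Sum>n<N. ?f n t)) \<longlonglongrightarrow> norm (h t)" if "t \<in> space (lebesgue_on {1/4<..})" for t
        using that h[of t] summable_LIMSEQ[OF summable_norm_cancel[OF pw[of t]]]
        by (auto intro!: tendsto_norm)
      show "(\<lambda>t. norm (\<Sum>n<N. ?f n t)) \<in> borel_measurable (lebesgue_on {1/4<..})" for N
        by (intro continuous_imp_measurable_on_sets_lebesgue continuous_intros) auto
    qed
    show "norm (norm (h t)) \<le> (\<Sum>n. norm (?f n t))" if "t \<in> {1/4<..}" for t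
      using summable_norm[OF pw[OF that]] by (simp add: h[OF that])
  qed (simp, intro sets_completionI_sets, simp)
  with int show "norm_integrable_on h {1/4<..}"
    by (auto simp: norm_integrable_on_def)
qed

end

theorem theorem5p1:
  fixes T :: "'a::cbanach \<Rightarrow>\<^sub>L 'a"
  assumes T: "T \<in> bounded_ops"
    and pb: "power_bounded (4 *\<^sub>C T)"
  shows
    \<comment> \<open>(i)\<close>
    "(summable (\<lambda>n. catalan n *\<^sub>C op_power T n) \<and>
      catalan_op T \<in> bounded_ops \<and>
      T o\<^sub>L catalan_op T = catalan_op T o\<^sub>L T \<and>
      (T o\<^sub>L op_power (catalan_op T) 2) - catalan_op T + id_blinfun = 0) \<and>
    \<comment> \<open>(ii)\<close>
    (\<forall>x. norm_integrable_on
            (\<lambda>t. (sqrt (t - 1/4) / t) *\<^sub>R blinfun_apply (resolvent T (of_real t)) x) {1/4<..} \<and>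
          blinfun_apply (catalan_op T) x =
            (1 / pi) *\<^sub>R integral {1/4<..}
              (\<lambda>t. (sqrt (t - 1/4) / t) *\<^sub>R blinfun_apply (resolvent T (of_real t)) x)) \<and>
    \<comment> \<open>(iii)\<close>
    T o\<^sub>L catalan_op T = (1 / 2) *\<^sub>C id_blinfun - sqrt_quarter_minus T \<and>
    \<comment> \<open>(iv)\<close>
    (op_spectrum (catalan_op T) = catalan_fun ` op_spectrum T \<and>
      op_spectrum (catalan_op T) \<subseteq> catalan_fun ` closure (ball 0 (1/4)) \<and>
      catalan_fun ` closure (ball 0 (1/4)) \<subseteq> l1_spectrum catalan) \<and>
    \<comment> \<open>(v)\<close>
    (\<forall>l. l \<noteq> 0 \<and> (l - 1) / l\<^sup>2 \<in> resolvent_set T \<longrightarrow>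
       l \<in> resolvent_set (catalan_op T) \<and>
       resolvent (catalan_op T) l =
         (1 / l) *\<^sub>C id_blinfun
         + (1 / l ^ 3) *\<^sub>C resolvent T ((l - 1) / l\<^sup>2)
         + (1 / l\<^sup>2) *\<^sub>C catalan_op T
         - ((l - 1) / l ^ 4) *\<^sub>C (catalan_op T o\<^sub>L resolvent T ((l - 1) / l\<^sup>2)))"
proof -
  obtain M where M: "\<And>n. norm (op_power (4 *\<^sub>C T) n) \<le> M"
    using pb unfolding power_bounded_def bdd_above_def by auto
  interpret quarter_power_bounded T M
  proof
    show "norm (op_power T n) \<le> M * (1 / 4) ^ n" for n
      using M[of n] by (simp add: op_power_scaleC T norm_scaleC norm_power power_divide field_simps)
  qed (rule T)
  have square: "T o\<^sub>L op_power (catalan_op T) 2 = catalan_op T - id_blinfun"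
    unfolding T_catalan_op_squared[symmetric] numeral_2_eq_2 op_power.simps
    by (rule blinfun_eqI) simp
  have "catalan_fun ` op_spectrum T \<subseteq> catalan_fun ` closure (ball 0 (1/4))"
    by (intro image_mono) (auto dest: spectrum_T_le)
  moreover have "catalan_fun ` closure (ball 0 (1/4)) \<subseteq> l1_spectrum catalan"
    by (auto intro: catalan_fun_in_l1_spectrum)
  ultimately show ?thesis
    using catalan_op_integral resolvent_eqI[OF is_op_inverse_catalan_op]
    by (intro conjI allI impI summable_catalan_op catalan_op_bounded T_catalan_op_commute
        T_catalan_op_eq_sqrt spectrum_catalan_op) (auto simp: square spectrum_catalan_op)
qed

end
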